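(* Let $G$ be a group and $\mathcal{L}$ an irreducible $G$-module. Let $V, V'$ be irreducible affine cones, each embedded in some $G$-module and closed under the $G$-action, with $\mathbb{P}(V), \mathbb{P}(V')$ nonempty. Let $T\colon \mathbb{P}(V) \to \mathrm{Gr}(N, \mathcal{L})$, $[x] \mapsto T_x$, and $U\colon \mathbb{P}(V') \to \mathrm{Gr}(N', \mathcal{L})$, $[y] \mapsto U_y$, be $G$-equivariant algebraic maps. For $m \in \mathbb{N}$ define $$a_m := \dim\left(\langle T_{x_1}, \ldots, T_{x_m} \rangle \cap U_y\right),$$ where $x_1,\ldots,x_m \in V$ and $y \in V'$ are generic points. If $m \in \mathbb{N}$ is such that $a_{m+1} = a_m \neq 0$, then $\langle T_{x_1}, \ldots, T_{x_m} \rangle = \mathcal{L}$ for generic $x_1,\ldots,x_m \in V$, and $a_m = N'$.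
   Context: Everything is over $\mathbb{C}$ and $G$-modules are finite-dimensional vector spaces with a linear $G$-action; a $G$-module is irreducible if it is nonzero and has no proper nonzero $G$-submodule. An affine cone is a Zariski closed subset $V$ of a vector space with $\mathbb{C}\cdot V \subseteq V$; $\mathbb{P}(V)$ is the corresponding projective variety. $\mathrm{Gr}(N, \mathcal{L})$ denotes the Grassmannian of $N$-dimensional linear subspaces of $\mathcal{L}$, with its canonical $G$-action. $\langle T_{x_1}, \ldots, T_{x_m}\rangle$ denotes the linear span (sum) of the subspaces $T_{x_i}$. "Generic" means in some nonempty Zariski open subset of $V^m \times V'$ (respectively $V^m$); $a_m$ is the constant value of the dimension on such a subset, and $a_0 = 0$. *)

theory Defs
  imports "HOL-Analysis.Analysis" "HOL-Algebra.Group_Action"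
begin

section \<open>Modules over a group\<close>

text \<open>
  A finite-dimensional complex vector space is written in coordinates, as \<open>complex ^ 'n\<close>.
  Linear algebra over the complex numbers is that of the locale interpretation \<open>vec\<close>
  (\<open>vec.span\<close>, \<open>vec.dim\<close>, \<dots>); the unqualified \<open>span\<close> and \<open>dim\<close> are over the reals.
\<close>

definition G_module ::
    "('g, 'r) monoid_scheme \<Rightarrow> ('g \<Rightarrow> complex ^ 'n \<Rightarrow> complex ^ 'n) \<Rightarrow> bool" where
  "G_module G \<rho> \<longleftrightarrow>
     group_action G UNIV \<rho> \<and>
     (\<forall>g\<in>carrier G. Vector_Spaces.linear (*s) (*s) (\<rho> g))"

definition G_submodule ::
    "('g, 'r) monoid_scheme \<Rightarrow> ('g \<Rightarrow> complex ^ 'n \<Rightarrow> complex ^ 'n) \<Rightarrow> (complex ^ 'n) set \<Rightarrow> bool" where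
  "G_submodule G \<rho> W \<longleftrightarrow> vec.subspace W \<and> (\<forall>g\<in>carrier G. \<rho> g ` W \<subseteq> W)"

definition irreducible_G_module ::
    "('g, 'r) monoid_scheme \<Rightarrow> ('g \<Rightarrow> complex ^ 'n \<Rightarrow> complex ^ 'n) \<Rightarrow> bool" where
  "irreducible_G_module G \<rho> \<longleftrightarrow>
     G_module G \<rho> \<and> (UNIV :: (complex ^ 'n) set) \<noteq> {0} \<and>
     (\<forall>W. G_submodule G \<rho> W \<longrightarrow> W = {0} \<or> W = UNIV)"

section \<open>Zariski topologies\<close>

text \<open>
  The algebra of functions generated by a set \<open>C\<close> of coordinate functions. As the complex
  field is infinite, polynomials may be identified with polynomial functions.
\<close>

inductive_set poly_functions :: "('a \<Rightarrow> complex) set \<Rightarrow> ('a \<Rightarrow> complex) set"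
  for C :: "('a \<Rightarrow> complex) set" where
  const: "(\<lambda>x. c) \<in> poly_functions C"
| coord: "f \<in> C \<Longrightarrow> f \<in> poly_functions C"
| add: "f \<in> poly_functions C \<Longrightarrow> g \<in> poly_functions C \<Longrightarrow> (\<lambda>x. f x + g x) \<in> poly_functions C"
| mult: "f \<in> poly_functions C \<Longrightarrow> g \<in> poly_functions C \<Longrightarrow> (\<lambda>x. f x * g x) \<in> poly_functions C"

text \<open>Open sets are the complements of zero sets of families of polynomials.\<close>

definition zariski :: "('a \<Rightarrow> complex) set \<Rightarrow> 'a topology" where
  "zariski C = topology (\<lambda>S. \<exists>F. F \<subseteq> poly_functions C \<and> S = - {x. \<forall>f\<in>F. f x = 0})"

lemma openin_zariski:
  "openin (zariski C) S \<longleftrightarrow> (\<exists>F. F \<subseteq> poly_functions C \<and> S = - {x. \<forall>f\<in>F. f x = 0})"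
proof -
  let ?P = "\<lambda>S. \<exists>F. F \<subseteq> poly_functions C \<and> S = - {x. \<forall>f\<in>F. f x = 0}"
  have "istopology ?P"
    unfolding istopology_def
  proof (intro conjI allI impI)
    fix S T assume "?P S" "?P T"
    then obtain F H where F: "F \<subseteq> poly_functions C" "S = - {x. \<forall>f\<in>F. f x = 0}"
      and H: "H \<subseteq> poly_functions C" "T = - {x. \<forall>f\<in>H. f x = 0}"
      by blast
    let ?K = "(\<lambda>(f, g) x. f x * g x) ` (F \<times> H)"
    have "?K \<subseteq> poly_functions C"
      using F(1) H(1) by (auto intro: poly_functions.mult)
    moreover have "S \<inter> T = - {x. \<forall>f\<in>?K. f x = 0}"
      using F(2) H(2) by auto
    ultimately show "?P (S \<inter> T)"
      by (intro exI[of _ ?K] conjI)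
  next
    fix \<K> assume *: "\<forall>K\<in>\<K>. ?P K"
    obtain F where "\<forall>K\<in>\<K>. F K \<subseteq> poly_functions C \<and> K = - {x. \<forall>f\<in>F K. f x = 0}"
      using bchoice[OF *] by (rule exE)
    then have F: "\<And>K. K \<in> \<K> \<Longrightarrow> F K \<subseteq> poly_functions C \<and> K = - {x. \<forall>f\<in>F K. f x = 0}"
      by (rule bspec)
    have "(\<Union>K\<in>\<K>. F K) \<subseteq> poly_functions C"
      by (rule UN_least) (rule conjunct1[OF F])
    moreover have "\<Union>\<K> = - {x. \<forall>f\<in>(\<Union>K\<in>\<K>. F K). f x = 0}"
    proof -
      have "(\<Union>K\<in>\<K>. K) = (\<Union>K\<in>\<K>. - {x. \<forall>f\<in>F K. f x = 0})"
        by (rule SUP_cong[OF refl]) (rule conjunct2[OF F])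
      then show ?thesis by blast
    qed
    ultimately show "?P (\<Union>\<K>)"
      by (intro exI[of _ "\<Union>K\<in>\<K>. F K"] conjI)
  qed
  then show ?thesis
    unfolding zariski_def by (simp add: topology_inverse')
qed

definition irreducible_space :: "'a topology \<Rightarrow> bool" where
  "irreducible_space X \<longleftrightarrow>
     topspace X \<noteq> {} \<and>
     (\<forall>A B. closedin X A \<and> closedin X B \<and> A \<union> B = topspace X \<longrightarrow>
            A = topspace X \<or> B = topspace X)"

definition generically :: "'a topology \<Rightarrow> ('a \<Rightarrow> bool) \<Rightarrow> bool" where
  "generically X P \<longleftrightarrow> (\<exists>S. openin X S \<and> S \<noteq> {} \<and> (\<forall>x\<in>S. P x))"

definition vec_coords :: "(complex ^ 'n \<Rightarrow> complex) set" where
  "vec_coords = range (\<lambda>j x. x $ j)"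

text \<open>
  The set \<open>V\<^sup>m\<close> consists of the extensional functions \<open>{..<m} \<rightarrow>\<^sub>E V\<close>; the points are
  indexed by \<open>0, \<dots>, m - 1\<close>.
\<close>

definition tuple_coords :: "nat \<Rightarrow> ((nat \<Rightarrow> complex ^ 'n) \<Rightarrow> complex) set" where
  "tuple_coords m = {\<lambda>x. x i $ j | i j. i < m}"

definition tuple_point_coords ::
    "nat \<Rightarrow> ((nat \<Rightarrow> complex ^ 'n) \<times> (complex ^ 'k) \<Rightarrow> complex) set" where
  "tuple_point_coords m =
     (\<lambda>f p. f (fst p)) ` tuple_coords m \<union> (\<lambda>f p. f (snd p)) ` vec_coords"

definition power_space :: "nat \<Rightarrow> (complex ^ 'n) set \<Rightarrow> (nat \<Rightarrow> complex ^ 'n) topology" where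
  "power_space m V = subtopology (zariski (tuple_coords m)) ({..<m} \<rightarrow>\<^sub>E V)"

definition power_prod_space ::
    "nat \<Rightarrow> (complex ^ 'n) set \<Rightarrow> (complex ^ 'k) set \<Rightarrow>
     ((nat \<Rightarrow> complex ^ 'n) \<times> (complex ^ 'k)) topology" where
  "power_prod_space m V V' =
     subtopology (zariski (tuple_point_coords m)) (({..<m} \<rightarrow>\<^sub>E V) \<times> V')"

section \<open>Affine cones and their projectivizations\<close>

definition affine_cone :: "(complex ^ 'n) set \<Rightarrow> bool" where
  "affine_cone V \<longleftrightarrow> closedin (zariski vec_coords) V \<and> (\<forall>c. \<forall>x\<in>V. c *s x \<in> V)"

definition irreducible_affine_cone :: "(complex ^ 'n) set \<Rightarrow> bool" where
  "irreducible_affine_cone V \<longleftrightarrow>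
     affine_cone V \<and> irreducible_space (subtopology (zariski vec_coords) V)"

text \<open>A point of projective space is a line through the origin.\<close>

definition proj_pt :: "complex ^ 'n \<Rightarrow> (complex ^ 'n) set" where
  "proj_pt x = vec.span {x}"

definition proj :: "(complex ^ 'n) set \<Rightarrow> (complex ^ 'n) set set" where
  "proj V = proj_pt ` (V - {0})"

inductive homogeneous_poly :: "nat \<Rightarrow> (complex ^ 'n \<Rightarrow> complex) \<Rightarrow> bool" where
  zero: "homogeneous_poly d (\<lambda>x. 0)"
| const: "homogeneous_poly 0 (\<lambda>x. c)"
| coord: "homogeneous_poly 1 (\<lambda>x. x $ j)"
| add: "homogeneous_poly d f \<Longrightarrow> homogeneous_poly d g \<Longrightarrow> homogeneous_poly d (\<lambda>x. f x + g x)"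
| mult: "homogeneous_poly d f \<Longrightarrow> homogeneous_poly e g \<Longrightarrow> homogeneous_poly (d + e) (\<lambda>x. f x * g x)"

text \<open>Closed sets of projective space are zero sets of families of homogeneous polynomials.\<close>

definition proj_zariski :: "(complex ^ 'n) set topology" where
  "proj_zariski = topology (\<lambda>S. \<exists>F. (\<forall>f\<in>F. \<exists>d. homogeneous_poly d f) \<and>
     S = proj UNIV - proj_pt ` {x. x \<noteq> 0 \<and> (\<forall>f\<in>F. f x = 0)})"

lemma homogeneous_poly_scale:
  "homogeneous_poly d f \<Longrightarrow> f (c *s x) = c ^ d * f x"
  by (induction rule: homogeneous_poly.induct) (auto simp: algebra_simps power_add)

lemma proj_pt_eqD:
  assumes "proj_pt x = proj_pt y"
  shows "\<exists>c. x = c *s y"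
proof -
  have "x \<in> vec.span {y}"
    using assms vec.span_base[of x "{x}"] by (auto simp: proj_pt_def)
  then show ?thesis
    by (auto simp: vec.span_singleton)
qed

lemma openin_proj_zariski:
  fixes S :: "(complex ^ 'n) set set"
  shows "openin proj_zariski S \<longleftrightarrow> (\<exists>F. (\<forall>f\<in>F. \<exists>d. homogeneous_poly d f) \<and>
     S = proj UNIV - proj_pt ` {x. x \<noteq> 0 \<and> (\<forall>f\<in>F. f x = 0)})"
proof -
  let ?H = "\<lambda>F :: (complex ^ 'n \<Rightarrow> complex) set. \<forall>f\<in>F. \<exists>d. homogeneous_poly d f"
  let ?U = "\<lambda>F :: (complex ^ 'n \<Rightarrow> complex) set. proj UNIV - proj_pt ` {x. x \<noteq> 0 \<and> (\<forall>f\<in>F. f x = 0)}"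
  let ?P = "\<lambda>S. \<exists>F. ?H F \<and> S = ?U F"
  have U: "?U F = proj_pt ` {x. x \<noteq> 0 \<and> (\<exists>f\<in>F. f x \<noteq> 0)}" if F: "?H F" for F
  proof -
    have disjoint: "proj_pt x \<noteq> proj_pt y" if f: "f \<in> F" "f x \<noteq> 0" and y: "\<forall>f\<in>F. f y = 0" for x y f
    proof
      assume "proj_pt x = proj_pt y"
      then obtain c where c: "x = c *s y"
        using proj_pt_eqD by blast
      obtain d where "homogeneous_poly d f"
        using F f(1) by blast
      then have "f x = c ^ d * f y"
        unfolding c by (rule homogeneous_poly_scale)
      then show False
        using f y by simp
    qed
    show ?thesis
    proof (intro subset_antisym subsetI)
      fix l assume "l \<in> ?U F"
      then show "l \<in> proj_pt ` {x. x \<noteq> 0 \<and> (\<exists>f\<in>F. f x \<noteq> 0)}"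
        unfolding proj_def by blast
    next
      fix l assume "l \<in> proj_pt ` {x. x \<noteq> 0 \<and> (\<exists>f\<in>F. f x \<noteq> 0)}"
      then obtain x f where x: "l = proj_pt x" "x \<noteq> 0" "f \<in> F" "f x \<noteq> 0"
        by blast
      then have "l \<in> proj UNIV"
        unfolding proj_def by blast
      then show "l \<in> ?U F"
        using disjoint[OF x(3,4)] x(1) by blast
    qed
  qed
  have "istopology ?P"
    unfolding istopology_def
  proof (intro conjI allI impI)
    fix S T assume "?P S" "?P T"
    then obtain F H where F: "?H F" "S = ?U F" and H: "?H H" "T = ?U H"
      by blast
    let ?K = "(\<lambda>(f, g) x. f x * g x) ` (F \<times> H)"
    have K: "?H ?K"
      using F(1) H(1) by (auto) (metis homogeneous_poly.mult)
    have "?U F \<inter> ?U H = ?U ?K"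
    proof (intro subset_antisym subsetI)
      fix l assume l: "l \<in> ?U F \<inter> ?U H"
      then obtain x where x: "l = proj_pt x" "x \<noteq> 0"
        unfolding proj_def by blast
      then obtain f g where "f \<in> F" "g \<in> H" "f x \<noteq> 0" "g x \<noteq> 0"
        using l by blast
      then have "\<exists>k\<in>?K. k x \<noteq> 0"
        by force
      then show "l \<in> ?U ?K"
        unfolding U[OF K] using x by blast
    next
      fix l assume "l \<in> ?U ?K"
      then obtain x where "l = proj_pt x" "x \<noteq> 0" "\<exists>k\<in>?K. k x \<noteq> 0"
        unfolding U[OF K] by blast
      then have "l = proj_pt x" "x \<noteq> 0" "\<exists>f\<in>F. f x \<noteq> 0" "\<exists>g\<in>H. g x \<noteq> 0"
        by auto
      then show "l \<in> ?U F \<inter> ?U H"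
        unfolding U[OF F(1)] U[OF H(1)] by blast
    qed
    then show "?P (S \<inter> T)" using F(2) H(2) K by (intro exI[of _ ?K]) simp
  next
    fix \<K> assume *: "\<forall>K\<in>\<K>. ?P K"
    obtain F where "\<forall>K\<in>\<K>. ?H (F K) \<and> K = ?U (F K)"
      using bchoice[OF *] by (rule exE)
    then have F: "\<And>K. K \<in> \<K> \<Longrightarrow> ?H (F K) \<and> K = ?U (F K)"
      by (rule bspec)
    have H: "?H (\<Union>K\<in>\<K>. F K)"
    proof
      fix f assume "f \<in> (\<Union>K\<in>\<K>. F K)"
      then obtain K where "K \<in> \<K>" "f \<in> F K" by (rule UN_E)
      then show "\<exists>d. homogeneous_poly d f"
        by (rule conjunct1[OF F, THEN bspec])
    qed
    have "(\<Union>K\<in>\<K>. K) = (\<Union>K\<in>\<K>. proj_pt ` {x. x \<noteq> 0 \<and> (\<exists>f\<in>F K. f x \<noteq> 0)})"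
    proof (rule SUP_cong[OF refl])
      fix K assume K: "K \<in> \<K>"
      show "K = proj_pt ` {x. x \<noteq> 0 \<and> (\<exists>f\<in>F K. f x \<noteq> 0)}"
        using conjunct2[OF F[OF K]] U[OF conjunct1[OF F[OF K]]] by (rule trans)
    qed
    also have "\<dots> = ?U (\<Union>K\<in>\<K>. F K)"
      unfolding U[OF H] by blast
    finally have "\<Union>\<K> = ?U (\<Union>K\<in>\<K>. F K)"
      by simp
    then show "?P (\<Union>\<K>)" using H by (intro exI[of _ "\<Union>K\<in>\<K>. F K"] conjI)
  qed
  then show ?thesis
    unfolding proj_zariski_def by (simp add: topology_inverse')
qed

section \<open>Algebraic maps to Grassmannians\<close>

definition Gr :: "nat \<Rightarrow> (complex ^ 'n) set set" where
  "Gr N = {W. vec.subspace W \<and> vec.dim W = N}"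

text \<open>
  Coordinates of \<open>w\<^sub>0 \<and> \<dots> \<and> w\<^sub>N\<^sub>-\<^sub>1\<close>, regarded as an alternating tensor: the entry at
  \<open>i = (i\<^sub>0, \<dots>, i\<^sub>N\<^sub>-\<^sub>1)\<close> is the minor of the matrix with columns \<open>w\<^sub>k\<close> on the rows \<open>i\<close>.
  All index tuples are kept, not only the increasing ones; the additional entries
  vanish or repeat others up to sign.
\<close>

definition plucker :: "nat \<Rightarrow> (nat \<Rightarrow> complex ^ 'n) \<Rightarrow> (nat \<Rightarrow> 'n) \<Rightarrow> complex" where
  "plucker N w i =
     (\<Sum>\<sigma> | \<sigma> permutes {..<N}. of_int (sign \<sigma>) * (\<Prod>k<N. w (\<sigma> k) $ i k))"

definition basis_of :: "nat \<Rightarrow> (nat \<Rightarrow> complex ^ 'n) \<Rightarrow> (complex ^ 'n) set \<Rightarrow> bool" where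
  "basis_of N w W \<longleftrightarrow>
     inj_on w {..<N} \<and> vec.independent (w ` {..<N}) \<and> vec.span (w ` {..<N}) = W"

text \<open>
  The family \<open>p\<close> is a vector of homogeneous coordinates for the image of \<open>W\<close> under the
  Pluecker embedding; changing the basis \<open>w\<close> only rescales the minors.
\<close>

definition plucker_point ::
    "nat \<Rightarrow> (complex ^ 'n) set \<Rightarrow> ((nat \<Rightarrow> 'n) \<Rightarrow> complex) \<Rightarrow> bool" where
  "plucker_point N W p \<longleftrightarrow>
     (\<exists>w c. basis_of N w W \<and> c \<noteq> 0 \<and> (\<forall>i \<in> {..<N} \<rightarrow>\<^sub>E UNIV. p i = c * plucker N w i))"

text \<open>
  The Grassmannian is a projective variety through its Pluecker embedding. A map into it is
  algebraic if near every point it is given by homogeneous polynomials of one common degree.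
\<close>

definition algebraic_map_Gr ::
    "(complex ^ 'n) set \<Rightarrow> nat \<Rightarrow> ((complex ^ 'n) set \<Rightarrow> (complex ^ 'l) set) \<Rightarrow> bool" where
  "algebraic_map_Gr V N T \<longleftrightarrow>
     T \<in> proj V \<rightarrow> Gr N \<and>
     (\<forall>l\<in>proj V. \<exists>S d F.
        openin (subtopology proj_zariski (proj V)) S \<and> l \<in> S \<and>
        (\<forall>i \<in> {..<N} \<rightarrow>\<^sub>E UNIV. homogeneous_poly d (F i)) \<and>
        (\<forall>x. x \<noteq> 0 \<and> proj_pt x \<in> S \<longrightarrow> plucker_point N (T (proj_pt x)) (\<lambda>i. F i x)))"

definition equivariant_Gr ::
    "('g, 'r) monoid_scheme \<Rightarrow> ('g \<Rightarrow> complex ^ 'n \<Rightarrow> complex ^ 'n) \<Rightarrow>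
     ('g \<Rightarrow> complex ^ 'l \<Rightarrow> complex ^ 'l) \<Rightarrow> (complex ^ 'n) set \<Rightarrow>
     ((complex ^ 'n) set \<Rightarrow> (complex ^ 'l) set) \<Rightarrow> bool" where
  "equivariant_Gr G \<rho> \<tau> V T \<longleftrightarrow>
     (\<forall>g\<in>carrier G. \<forall>l\<in>proj V. T (\<rho> g ` l) = \<tau> g ` T l)"

section \<open>The generic dimension of intersection\<close>

definition span_of_tuple ::
    "nat \<Rightarrow> ((complex ^ 'n) set \<Rightarrow> (complex ^ 'l) set) \<Rightarrow> (nat \<Rightarrow> complex ^ 'n) \<Rightarrow> (complex ^ 'l) set" where
  "span_of_tuple m T x = vec.span (\<Union>i<m. T (proj_pt (x i)))"

text \<open>
  Points at which some \<open>x\<^sub>i\<close> or \<open>y\<close> is \<open>0\<close> define no point of projective space, and are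
  excluded from the generic set. For irreducible \<open>V\<close> and \<open>V'\<close> two nonempty open sets meet,
  so at most one value is generic. One exists because the intersection has dimension
  \<open>dim A + dim B - dim (A + B)\<close>, and dimensions of spans are lower semicontinuous. For \<open>m = 0\<close> the span is \<open>{0}\<close> and the
  generic dimension is \<open>0\<close>.
\<close>

definition generic_dim ::
    "(complex ^ 'n) set \<Rightarrow> (complex ^ 'k) set \<Rightarrow> ((complex ^ 'n) set \<Rightarrow> (complex ^ 'l) set) \<Rightarrow>
     ((complex ^ 'k) set \<Rightarrow> (complex ^ 'l) set) \<Rightarrow> nat \<Rightarrow> nat" where
  "generic_dim V V' T U m =
     (THE a. generically (power_prod_space m V V')
        (\<lambda>(x, y). (\<forall>i<m. x i \<noteq> 0) \<and> y \<noteq> 0 \<and>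
                  vec.dim (span_of_tuple m T x \<inter> U (proj_pt y)) = a))"

end

theory Submission
  imports Defs
begin

text \<open>
  Write \<open>S x\<close> for the span of \<open>T x\<^sub>0, \<dots>, T x\<^sub>m\<^sub>-\<^sub>1\<close>, and let \<open>M\<close> be the set of vectors of the
  irreducible module that lie in \<open>S x\<close> for generic \<open>x\<close> (\<open>generic_vectors\<close>). The set \<open>M\<close> is a
  subspace, because two generic conditions on an irreducible set hold simultaneously, and it is
  stable under the group, because a group element moves \<open>S x\<close> to \<open>S (g x)\<close> and acts on \<open>V\<^sup>m\<close> by
  invertible polynomial maps. Hence \<open>M\<close> is either zero or everything. If it is everything, then
  applying its definition to each vector of a basis shows that \<open>S x\<close> is generically the whole
  module, and its intersection with \<open>U y\<close> has dimension \<open>N'\<close>. So the task is to find a nonzero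
  vector in \<open>M\<close>, and this is where the stabilization \<open>a\<^sub>m\<^sub>+\<^sub>1 = a\<^sub>m\<close> enters.

  Take a generic point \<open>(z, y)\<close> of \<open>V\<^sup>2\<^sup>m \<times> V'\<close>, and slide a window of length \<open>m\<close> along \<open>z\<close>. Two
  neighbouring windows are both contained in a window of length \<open>m + 1\<close>. As
  \<open>a\<^sub>m = a\<^sub>m\<^sub>+\<^sub>1\<close>, all three spans cut out the same subspace of \<open>U y\<close>. Therefore the first and
  the last window, which share no point, give the same intersection with \<open>U y\<close>. Now fix \<open>y\<close> and
  the first half of \<open>z\<close>: the resulting fixed subspace, of dimension \<open>a\<^sub>m \<noteq> 0\<close>, lies in the span
  of a generic second half, that is, it lies in \<open>M\<close>.

  For this argument one must know that the number \<open>a\<^sub>m\<close> really is attained generically. Locally, a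
  subspace with polynomial Pluecker coordinates has a frame of vectors with polynomial
  coordinates (\<open>algebraic_map_framed\<close>), so the dimensions of \<open>S x\<close> and of \<open>S x + U y\<close> are lower
  semicontinuous and generically equal to their maxima; the dimension of \<open>S x \<inter> U y\<close> is then
  determined by the dimension formula.
\<close>

section \<open>Minors and linear independence\<close>

text \<open>
  Contracting the alternating tensor \<open>w\<^sub>0 \<and> \<dots> \<and> w\<^sub>N\<^sub>-\<^sub>1\<close> with the coordinate forms \<open>i\<close> in all
  slots but the \<open>k\<close>-th leaves a vector in the span of the \<open>w\<^sub>a\<close>. These vectors recover
  a subspace from its Pluecker coordinates alone.
\<close>

definition minor_vec :: "nat \<Rightarrow> (nat \<Rightarrow> complex ^ 'n) \<Rightarrow> (nat \<Rightarrow> 'n) \<Rightarrow> nat \<Rightarrow> complex ^ 'n" where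
  "minor_vec N w i k = (\<chi> j. plucker N w (i(k := j)))"

definition row_cofactor :: "nat \<Rightarrow> (nat \<Rightarrow> complex ^ 'n) \<Rightarrow> (nat \<Rightarrow> 'n) \<Rightarrow> nat \<Rightarrow> nat \<Rightarrow> complex" where
  "row_cofactor N w i k a =
     (\<Sum>\<sigma> | \<sigma> permutes {..<N} \<and> \<sigma> k = a. of_int (sign \<sigma>) * (\<Prod>k'\<in>{..<N} - {k}. w (\<sigma> k') $ i k'))"

lemma plucker_cong: "(\<And>k. k < N \<Longrightarrow> i k = i' k) \<Longrightarrow> plucker N w i = plucker N w i'"
  unfolding plucker_def by (intro sum.cong refl arg_cong2[where f="(*)"] prod.cong) auto

text \<open>
  Laplace expansion along row \<open>k\<close>: the permutations are grouped by the value \<open>\<sigma> k\<close>. The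
  cofactors do not involve row \<open>k\<close>, so they serve for all \<open>j\<close> at once.
\<close>

lemma minor_vec_row_expansion:
  assumes "k < N"
  shows "minor_vec N w i k = (\<Sum>a<N. row_cofactor N w i k a *s w a)"
proof (simp add: vec_eq_iff minor_vec_def, rule allI)
  fix j
  let ?P = "{\<sigma>. \<sigma> permutes {..<N}}"
  let ?g = "\<lambda>\<sigma>. of_int (sign \<sigma>) * (\<Prod>k'\<in>{..<N} - {k}. w (\<sigma> k') $ i k') * w (\<sigma> k) $ j"
  have "plucker N w (i(k := j)) = (\<Sum>\<sigma>\<in>?P. ?g \<sigma>)"
    unfolding plucker_def
  proof (rule sum.cong)
    fix \<sigma>
    have "(\<Prod>k'<N. w (\<sigma> k') $ (i(k := j)) k')
      = w (\<sigma> k) $ j * (\<Prod>k'\<in>{..<N} - {k}. w (\<sigma> k') $ (i(k := j)) k')"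
      using assms by (subst prod.remove[of _ k]) auto
    also have "(\<Prod>k'\<in>{..<N} - {k}. w (\<sigma> k') $ (i(k := j)) k') = (\<Prod>k'\<in>{..<N} - {k}. w (\<sigma> k') $ i k')"
      by (rule prod.cong) auto
    finally show "of_int (sign \<sigma>) * (\<Prod>k'<N. w (\<sigma> k') $ (i(k := j)) k') = ?g \<sigma>"
      by simp
  qed simp
  also have "\<dots> = (\<Sum>a<N. \<Sum>\<sigma> | \<sigma> \<in> ?P \<and> \<sigma> k = a. ?g \<sigma>)"
    using assms by (intro sum.group[symmetric] finite_permutations finite_lessThan)
      (auto dest: permutes_in_image)
  also have "\<dots> = (\<Sum>a<N. row_cofactor N w i k a * w a $ j)"
    unfolding row_cofactor_def sum_distrib_right by (intro sum.cong refl) auto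
  finally show "plucker N w (i(k := j)) = (\<Sum>a<N. row_cofactor N w i k a * w a $ j)" .
qed

lemma row_cofactor_last: "row_cofactor (Suc N) w i N N = plucker N w i"
proof -
  have "{\<sigma>. \<sigma> permutes {..<Suc N} \<and> \<sigma> N = N} = {\<sigma>. \<sigma> permutes {..<N}}"
    by (auto intro: permutes_superset permutes_subset simp: less_Suc_eq permutes_not_in)
  moreover have "{..<Suc N} - {N} = {..<N}" by auto
  ultimately show ?thesis
    unfolding row_cofactor_def plucker_def by simp
qed

text \<open>
  Composition with the transposition of the two equal rows permutes the terms and reverses their
  signs.
\<close>

lemma plucker_repeated_row:
  assumes "k < N" "k' < N" "k \<noteq> k'" "i k = i k'"
  shows "plucker N w i = 0"
proof -
  let ?\<tau> = "Transposition.transpose k k'"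
  let ?g = "\<lambda>\<sigma>. of_int (sign \<sigma>) * (\<Prod>a<N. w (\<sigma> a) $ i a)"
  have \<tau>: "?\<tau> permutes {..<N}"
    using assms by (intro permutes_swap_id) auto
  have "plucker N w i = (\<Sum>\<sigma> | \<sigma> permutes {..<N}. ?g (\<sigma> \<circ> ?\<tau>))"
    unfolding plucker_def by (rule sum_permutations_compose_right[OF \<tau>])
  also have "\<dots> = (\<Sum>\<sigma> | \<sigma> permutes {..<N}. - ?g \<sigma>)"
  proof (rule sum.cong)
    fix \<sigma> assume "\<sigma> \<in> {\<sigma>. \<sigma> permutes {..<N}}"
    then have "sign (\<sigma> \<circ> ?\<tau>) = - sign \<sigma>"
      using assms(3) \<tau> by (subst sign_compose)
        (auto simp: sign_swap_id intro: permutes_imp_permutation[of "{..<N}"])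
    moreover have "(\<Prod>a<N. w (\<sigma> a) $ i a) = (\<Prod>a<N. w ((\<sigma> \<circ> ?\<tau>) a) $ i a)"
    proof -
      have "(\<Prod>a<N. w (\<sigma> a) $ i a) = (\<Prod>a<N. w (\<sigma> (?\<tau> a)) $ i (?\<tau> a))"
        by (rule prod.permute[OF \<tau>, of "\<lambda>a. w (\<sigma> a) $ i a", unfolded o_def])
      moreover have "i (?\<tau> a) = i a" for a
        using assms(4) by (auto simp: Transposition.transpose_def)
      ultimately show ?thesis by simp
    qed
    ultimately show "?g (\<sigma> \<circ> ?\<tau>) = - ?g \<sigma>" by simp
  qed simp
  also have "\<dots> = - plucker N w i"
    unfolding plucker_def by (rule sum_negf)
  finally show ?thesis by simp
qed

text \<open>
  On the rows \<open>i\<close>, the vectors \<open>minor_vec N w i k\<close> form a nonzero multiple of the identity matrix,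
  because replacing one row by another produces a repeated row. They are thus \<open>N\<close> independent vectors
  in a span of \<open>N\<close> vectors.
\<close>

lemma span_minor_vec:
  assumes "plucker N w i \<noteq> 0"
  shows "vec.span (minor_vec N w i ` {..<N}) = vec.span (w ` {..<N})"
    and "vec.dim (w ` {..<N}) = N"
proof -
  let ?u = "minor_vec N w i"
  have entry: "?u k $ i k' = (if k = k' then plucker N w i else 0)" if "k < N" "k' < N" for k k'
    using that plucker_repeated_row[of k N k' "i(k := i k')"] by (auto simp: minor_vec_def)
  have inj: "inj_on ?u {..<N}"
    using entry assms by (intro inj_onI) (metis lessThan_iff)
  have indep: "vec.independent (?u ` {..<N})"
  proof (rule vec.independent_if_scalars_zero)
    fix f x assume 0: "(\<Sum>x\<in>?u ` {..<N}. f x *s x) = 0" and "x \<in> ?u ` {..<N}"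
    then obtain k where k: "x = ?u k" "k < N" by auto
    have "0 = (\<Sum>a<N. f (?u a) *s ?u a) $ i k"
      using 0 inj by (simp add: sum.reindex)
    also have "\<dots> = (\<Sum>a<N. f (?u a) * (if a = k then plucker N w i else 0))"
      unfolding sum_component vector_smult_component using k entry by (intro sum.cong) auto
    also have "\<dots> = f (?u k) * plucker N w i"
      using k by (simp add: if_distrib cong: if_cong)
    finally show "f x = 0" using assms k by simp
  qed simp
  have sub: "?u ` {..<N} \<subseteq> vec.span (w ` {..<N})"
    by (auto simp: minor_vec_row_expansion intro!: vec.span_sum vec.span_scale intro: vec.span_base)
  have "card (?u ` {..<N}) = N"
    using inj by (simp add: card_image)
  then have "N \<le> vec.dim (w ` {..<N})"
    using vec.independent_card_le_dim[OF sub indep] by simp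
  moreover have "vec.dim (w ` {..<N}) \<le> N"
    using vec.dim_le_card[OF vec.span_superset, of "w ` {..<N}"] card_image_le[of "{..<N}" w] by simp
  ultimately show dim: "vec.dim (w ` {..<N}) = N" by simp
  have "vec.dim (?u ` {..<N}) = N"
    using indep \<open>card _ = N\<close> by (simp add: vec.dim_eq_card_independent)
  with dim sub show "vec.span (?u ` {..<N}) = vec.span (w ` {..<N})"
    using vec.subspace_dim_equal[of "vec.span (?u ` {..<N})" "vec.span (w ` {..<N})"]
    by (simp add: vec.span_minimal)
qed

text \<open>
  Take a nonvanishing minor of the first \<open>N\<close> vectors. If all minors of \<open>N + 1\<close> vectors were
  zero, then expansion along the new row would give a linear relation in which the last vector has
  that minor as its coefficient.
\<close>

lemma independent_imp_plucker_nonzero: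
  fixes w :: "nat \<Rightarrow> complex ^ 'n"
  assumes "inj_on w {..<N}" "vec.independent (w ` {..<N})"
  shows "\<exists>i. plucker N w i \<noteq> 0"
  using assms
proof (induction N)
  case 0
  show ?case by (simp add: plucker_def)
next
  case (Suc N)
  have "vec.independent (w ` {..<N})"
    by (rule vec.independent_mono[OF Suc.prems(2)]) auto
  then obtain i where i: "plucker N w i \<noteq> 0"
    using Suc inj_on_subset by (metis lessThan_subset_iff lessI less_imp_le)
  show ?case
  proof (rule ccontr)
    assume "\<not> ?thesis"
    then have "minor_vec (Suc N) w i N = 0"
      by (simp add: minor_vec_def vec_eq_iff)
    then have sum0: "(\<Sum>a<N. row_cofactor (Suc N) w i N a *s w a) + plucker N w i *s w N = 0"
      by (simp add: minor_vec_row_expansion row_cofactor_last)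
    have "w N \<in> vec.span (w ` {..<N})"
    proof -
      have "plucker N w i *s w N = - (\<Sum>a<N. row_cofactor (Suc N) w i N a *s w a)"
        using sum0 by (metis add_eq_0_iff)
      then have "plucker N w i *s w N \<in> vec.span (w ` {..<N})"
        by (auto intro!: vec.span_neg vec.span_sum intro: vec.span_scale vec.span_base)
      then show ?thesis using i by (metis vec.span_scale vector_smult_assoc vector_smult_lid left_inverse)
    qed
    moreover have "w N \<notin> w ` {..<N}"
      using inj_onD[OF Suc.prems(1), of N] by force
    ultimately show False
      using Suc.prems(2) by (auto simp: lessThan_Suc vec.independent_insert)
  qed
qed

section \<open>Generic properties on irreducible sets\<close>

lemma poly_functions_sum:
  "(\<And>a. a \<in> I \<Longrightarrow> f a \<in> poly_functions C) \<Longrightarrow> (\<lambda>x. \<Sum>a\<in>I. f a x) \<in> poly_functions C"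
  by (induction I rule: infinite_finite_induct) (auto intro: poly_functions.intros)

lemma poly_functions_prod:
  "(\<And>a. a \<in> I \<Longrightarrow> f a \<in> poly_functions C) \<Longrightarrow> (\<lambda>x. \<Prod>a\<in>I. f a x) \<in> poly_functions C"
  by (induction I rule: infinite_finite_induct) (auto intro: poly_functions.intros)

lemma poly_functions_compose:
  assumes "f \<in> poly_functions C" "\<And>c. c \<in> C \<Longrightarrow> (\<lambda>x. c (\<phi> x)) \<in> poly_functions D"
  shows "(\<lambda>x. f (\<phi> x)) \<in> poly_functions D"
  using assms(1) by induction (auto intro: poly_functions.intros assms(2))

lemma poly_functions_homogeneous:
  "homogeneous_poly d f \<Longrightarrow> f \<in> poly_functions vec_coords"
  by (induction rule: homogeneous_poly.induct) (auto intro: poly_functions.intros simp: vec_coords_def)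

lemma poly_functions_plucker:
  assumes "\<And>k j. k < N \<Longrightarrow> (\<lambda>p. w k p $ j) \<in> poly_functions C"
  shows "(\<lambda>p. plucker N (\<lambda>k. w k p) i) \<in> poly_functions C"
  unfolding plucker_def
  by (intro poly_functions_sum poly_functions.mult poly_functions.const poly_functions_prod assms)
    (auto dest: permutes_in_image)

text \<open>
  On a subset of a Zariski space every nonempty open set contains a nonempty basic open set, the
  locus where one polynomial does not vanish. Genericity and irreducibility can thus be expressed with
  single polynomials, which are easy to pull back and to restrict to slices.
\<close>

definition generic_on :: "('a \<Rightarrow> complex) set \<Rightarrow> 'a set \<Rightarrow> ('a \<Rightarrow> bool) \<Rightarrow> bool" where
  "generic_on C X P \<longleftrightarrow>
     (\<exists>f\<in>poly_functions C. (\<exists>x\<in>X. f x \<noteq> 0) \<and> (\<forall>x\<in>X. f x \<noteq> 0 \<longrightarrow> P x))"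

definition irreducible_on :: "('a \<Rightarrow> complex) set \<Rightarrow> 'a set \<Rightarrow> bool" where
  "irreducible_on C X \<longleftrightarrow> X \<noteq> {} \<and>
     (\<forall>f\<in>poly_functions C. \<forall>g\<in>poly_functions C.
        (\<exists>x\<in>X. f x \<noteq> 0) \<longrightarrow> (\<exists>x\<in>X. g x \<noteq> 0) \<longrightarrow> (\<exists>x\<in>X. f x \<noteq> 0 \<and> g x \<noteq> 0))"

lemma irreducible_onD:
  assumes "irreducible_on C X" "f \<in> poly_functions C" "g \<in> poly_functions C"
    and "x \<in> X" "f x \<noteq> 0" "y \<in> X" "g y \<noteq> 0"
  shows "\<exists>z\<in>X. f z \<noteq> 0 \<and> g z \<noteq> 0"
  using assms unfolding irreducible_on_def by blast

lemma openin_zariski_nonzero: "f \<in> poly_functions C \<Longrightarrow> openin (zariski C) {x. f x \<noteq> 0}"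
  unfolding openin_zariski by (rule exI[of _ "{f}"]) auto

lemma topspace_zariski: "topspace (zariski C) = UNIV"
  using openin_subset[OF openin_zariski_nonzero[OF poly_functions.const[of 1 C]]] by auto

lemma generically_iff_generic_on:
  "generically (subtopology (zariski C) X) P \<longleftrightarrow> generic_on C X P"
proof
  assume "generically (subtopology (zariski C) X) P"
  then obtain F x where F: "F \<subseteq> poly_functions C" "x \<in> X" "x \<in> - {x. \<forall>f\<in>F. f x = 0}"
    and P: "\<forall>x \<in> - {x. \<forall>f\<in>F. f x = 0} \<inter> X. P x"
    unfolding generically_def openin_subtopology openin_zariski by blast
  then obtain f where "f \<in> F" "f x \<noteq> 0" by blast
  then show "generic_on C X P"
    unfolding generic_on_def using F P by (intro bexI[of _ f]) auto
next
  assume "generic_on C X P"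
  then obtain f where f: "f \<in> poly_functions C" "\<exists>x\<in>X. f x \<noteq> 0" "\<forall>x\<in>X. f x \<noteq> 0 \<longrightarrow> P x"
    unfolding generic_on_def by blast
  then have "openin (subtopology (zariski C) X) ({x. f x \<noteq> 0} \<inter> X)"
    by (auto intro: openin_subtopology_Int openin_zariski_nonzero)
  then show "generically (subtopology (zariski C) X) P"
    unfolding generically_def using f by (intro exI[of _ "{x. f x \<noteq> 0} \<inter> X"]) auto
qed

lemma irreducible_space_imp_irreducible_on:
  assumes "irreducible_space (subtopology (zariski C) X)"
  shows "irreducible_on C X"
  unfolding irreducible_on_def
proof (intro conjI ballI impI)
  let ?X = "subtopology (zariski C) X"
  have top: "topspace ?X = X" by (simp add: topspace_zariski)
  show "X \<noteq> {}" using assms unfolding irreducible_space_def top by blast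
  fix f g assume fg: "f \<in> poly_functions C" "g \<in> poly_functions C"
    and ne: "\<exists>x\<in>X. f x \<noteq> 0" "\<exists>x\<in>X. g x \<noteq> 0"
  have closed: "closedin ?X {x \<in> X. h x = 0}" if "h \<in> poly_functions C" for h
  proof -
    have "X - {x \<in> X. h x = 0} = {x. h x \<noteq> 0} \<inter> X" by auto
    then show ?thesis
      unfolding closedin_def top using openin_zariski_nonzero[OF that]
      by (auto intro: openin_subtopology_Int)
  qed
  show "\<exists>x\<in>X. f x \<noteq> 0 \<and> g x \<noteq> 0"
  proof (rule ccontr)
    assume "\<not> ?thesis"
    then have "{x \<in> X. f x = 0} \<union> {x \<in> X. g x = 0} = X" by auto
    then have "{x \<in> X. f x = 0} = X \<or> {x \<in> X. g x = 0} = X"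
      using assms closed fg unfolding irreducible_space_def top by blast
    then show False using ne by blast
  qed
qed

lemma generic_on_mono:
  "generic_on C X P \<Longrightarrow> (\<And>x. x \<in> X \<Longrightarrow> P x \<Longrightarrow> Q x) \<Longrightarrow> generic_on C X Q"
  unfolding generic_on_def by blast

lemma generic_on_conj:
  assumes "irreducible_on C X" "generic_on C X P" "generic_on C X Q"
  shows "generic_on C X (\<lambda>x. P x \<and> Q x)"
proof -
  obtain f g where f: "f \<in> poly_functions C" "\<exists>x\<in>X. f x \<noteq> 0" "\<forall>x\<in>X. f x \<noteq> 0 \<longrightarrow> P x"
    and g: "g \<in> poly_functions C" "\<exists>x\<in>X. g x \<noteq> 0" "\<forall>x\<in>X. g x \<noteq> 0 \<longrightarrow> Q x"
    using assms unfolding generic_on_def by blast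
  have "(\<lambda>x. f x * g x) \<in> poly_functions C"
    using f g by (auto intro: poly_functions.mult)
  moreover have "\<exists>x\<in>X. f x * g x \<noteq> 0"
    using assms(1) f g unfolding irreducible_on_def by simp
  ultimately show ?thesis
    unfolding generic_on_def using f g by (intro bexI[of _ "\<lambda>x. f x * g x"]) auto
qed

lemma generic_on_ball:
  assumes "irreducible_on C X" "finite I" "\<And>a. a \<in> I \<Longrightarrow> generic_on C X (P a)"
  shows "generic_on C X (\<lambda>x. \<forall>a\<in>I. P a x)"
  using assms(2,3)
proof (induction I)
  case empty
  have "generic_on C X (\<lambda>x. True)"
    using assms(1) unfolding generic_on_def irreducible_on_def
    by (intro bexI[of _ "\<lambda>x. 1"]) (auto intro: poly_functions.const)
  then show ?case by simp
next
  case (insert a I)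
  then show ?case using generic_on_conj[OF assms(1), of "P a" "\<lambda>x. \<forall>a\<in>I. P a x"] by simp
qed

lemma generic_on_ex: "generic_on C X P \<Longrightarrow> \<exists>x\<in>X. P x"
  unfolding generic_on_def by blast

lemma generic_on_pullback:
  assumes "generic_on C X P" "\<phi> ` Y = X"
    and "\<And>c. c \<in> C \<Longrightarrow> (\<lambda>y. c (\<phi> y)) \<in> poly_functions D"
  shows "generic_on D Y (\<lambda>y. P (\<phi> y))"
proof -
  obtain f where f: "f \<in> poly_functions C" "\<exists>x\<in>X. f x \<noteq> 0" "\<forall>x\<in>X. f x \<noteq> 0 \<longrightarrow> P x"
    using assms unfolding generic_on_def by blast
  then show ?thesis
    unfolding generic_on_def
    using assms(2) poly_functions_compose[OF f(1) assms(3)]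
    by (intro bexI[of _ "\<lambda>y. f (\<phi> y)"]) auto
qed

text \<open>
  If \<open>f\<close> and \<open>g\<close> do not vanish at \<open>(x, y)\<close> and \<open>(x', y')\<close>, then irreducibility of the first
  factor yields \<open>x\<^sub>0\<close> with \<open>f (x\<^sub>0, y)\<close> and \<open>g (x\<^sub>0, y')\<close> both nonzero, and irreducibility of the
  second yields a common \<open>y\<^sub>0\<close>. Only slices of \<open>\<phi>\<close> have to be polynomial. Taking the image of a
  product covers both adding a point to a tuple and pairing tuples with points.
\<close>

lemma irreducible_on_product_image:
  assumes "irreducible_on C X" "irreducible_on D Y" "Z = case_prod \<phi> ` (X \<times> Y)"
    and "\<And>y c. y \<in> Y \<Longrightarrow> c \<in> E \<Longrightarrow> (\<lambda>x. c (\<phi> x y)) \<in> poly_functions C"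
    and "\<And>x c. x \<in> X \<Longrightarrow> c \<in> E \<Longrightarrow> (\<lambda>y. c (\<phi> x y)) \<in> poly_functions D"
  shows "irreducible_on E Z"
  unfolding irreducible_on_def
proof (intro conjI ballI impI)
  show "Z \<noteq> {}"
    using assms(1-3) unfolding irreducible_on_def by auto
  fix f g assume fg: "f \<in> poly_functions E" "g \<in> poly_functions E"
    and "\<exists>z\<in>Z. f z \<noteq> 0" "\<exists>z\<in>Z. g z \<noteq> 0"
  from this(3,4) obtain x y x' y' where xy: "x \<in> X" "y \<in> Y" "x' \<in> X" "y' \<in> Y" "f (\<phi> x y) \<noteq> 0" "g (\<phi> x' y') \<noteq> 0"
    unfolding assms(3) by auto
  have fX: "(\<lambda>x. f (\<phi> x y)) \<in> poly_functions C"
    by (rule poly_functions_compose[where \<phi> = "\<lambda>x. \<phi> x y", OF fg(1) assms(4)[OF xy(2)]])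
  have gX: "(\<lambda>x. g (\<phi> x y')) \<in> poly_functions C"
    by (rule poly_functions_compose[where \<phi> = "\<lambda>x. \<phi> x y'", OF fg(2) assms(4)[OF xy(4)]])
  then obtain x0 where x0: "x0 \<in> X" "f (\<phi> x0 y) \<noteq> 0" "g (\<phi> x0 y') \<noteq> 0"
    using irreducible_onD[OF assms(1) fX gX, of x x'] xy by blast
  have fY: "(\<lambda>y. f (\<phi> x0 y)) \<in> poly_functions D"
    by (rule poly_functions_compose[where \<phi> = "\<phi> x0", OF fg(1) assms(5)[OF x0(1)]])
  have gY: "(\<lambda>y. g (\<phi> x0 y)) \<in> poly_functions D"
    by (rule poly_functions_compose[where \<phi> = "\<phi> x0", OF fg(2) assms(5)[OF x0(1)]])
  then obtain y0 where "y0 \<in> Y" "f (\<phi> x0 y0) \<noteq> 0" "g (\<phi> x0 y0) \<noteq> 0"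
    using irreducible_onD[OF assms(2) fY gY, of y y'] xy x0 by blast
  then show "\<exists>z\<in>Z. f z \<noteq> 0 \<and> g z \<noteq> 0"
    using x0 unfolding assms(3) by auto
qed

lemma tuple_coordI: "i < m \<Longrightarrow> (\<lambda>x. x i $ j) \<in> poly_functions (tuple_coords m)"
  unfolding tuple_coords_def by (auto intro!: poly_functions.coord)

lemma vec_coordI: "(\<lambda>x. x $ j) \<in> poly_functions vec_coords"
  unfolding vec_coords_def by (auto intro: poly_functions.coord)

lemma tuple_point_coordI:
  "i < m \<Longrightarrow> (\<lambda>p. fst p i $ j) \<in> poly_functions (tuple_point_coords m)"
  "(\<lambda>p. snd p $ j') \<in> poly_functions (tuple_point_coords m)"
  unfolding tuple_point_coords_def tuple_coords_def vec_coords_def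
  by (rule poly_functions.coord, rule UnI1, rule image_eqI[where x = "\<lambda>x. x i $ j"], simp, blast)
    (rule poly_functions.coord, rule UnI2, rule image_eqI[where x = "\<lambda>x. x $ j'"], simp, blast)

lemma irreducible_on_tuples:
  fixes V :: "(complex ^ 'n) set"
  assumes "irreducible_on vec_coords V"
  shows "irreducible_on (tuple_coords m) ({..<m} \<rightarrow>\<^sub>E V)"
proof (induction m)
  case 0
  \<comment> \<open>The space of empty tuples is a single point, with only constant polynomials.\<close>
  have "tuple_coords 0 = ({} :: ((nat \<Rightarrow> complex ^ 'n) \<Rightarrow> complex) set)"
    by (simp add: tuple_coords_def)
  then show ?case by (simp add: irreducible_on_def)
next
  case (Suc m)
  show ?case
  proof (rule irreducible_on_product_image[OF assms Suc, where \<phi> = "\<lambda>v x. x(m := v)"])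
    show "({..<Suc m} \<rightarrow>\<^sub>E V) = (\<lambda>(v, x). x(m := v)) ` (V \<times> ({..<m} \<rightarrow>\<^sub>E V))"
      by (simp add: lessThan_Suc PiE_insert_eq)
  next
    fix x :: "nat \<Rightarrow> complex ^ 'n" and c :: "(nat \<Rightarrow> complex ^ 'n) \<Rightarrow> complex"
    assume "c \<in> tuple_coords (Suc m)"
    then obtain i j where "c = (\<lambda>x. x i $ j)" by (auto simp: tuple_coords_def)
    then show "(\<lambda>v. c (x(m := v))) \<in> poly_functions vec_coords"
      by (cases "i = m") (auto intro: vec_coordI poly_functions.const)
  next
    fix v :: "complex ^ 'n" and c :: "(nat \<Rightarrow> complex ^ 'n) \<Rightarrow> complex"
    assume "c \<in> tuple_coords (Suc m)"
    then obtain i j where "c = (\<lambda>x. x i $ j)" "i < Suc m" by (auto simp: tuple_coords_def)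
    then show "(\<lambda>x. c (x(m := v))) \<in> poly_functions (tuple_coords m)"
      by (auto intro: tuple_coordI poly_functions.const simp: less_Suc_eq)
  qed
qed

lemma tuple_point_coordsE:
  assumes "c \<in> tuple_point_coords m"
  obtains i j where "i < m" "c = (\<lambda>p. fst p i $ j)" | j where "c = (\<lambda>p. snd p $ j)"
  using assms unfolding tuple_point_coords_def tuple_coords_def vec_coords_def by auto

lemma irreducible_on_tuple_points:
  fixes V :: "(complex ^ 'n) set" and V' :: "(complex ^ 'k) set"
  assumes "irreducible_on vec_coords V" "irreducible_on vec_coords V'"
  shows "irreducible_on (tuple_point_coords m) (({..<m} \<rightarrow>\<^sub>E V) \<times> V')"
proof (rule irreducible_on_product_image[OF irreducible_on_tuples[OF assms(1)] assms(2), where \<phi> = Pair])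
  fix x :: "nat \<Rightarrow> complex ^ 'n" and y :: "complex ^ 'k"
    and c :: "(nat \<Rightarrow> complex ^ 'n) \<times> (complex ^ 'k) \<Rightarrow> complex"
  assume c: "c \<in> tuple_point_coords m"
  show "(\<lambda>x. c (x, y)) \<in> poly_functions (tuple_coords m)"
    using c by (cases rule: tuple_point_coordsE) (auto intro: tuple_coordI poly_functions.const)
  show "(\<lambda>y. c (x, y)) \<in> poly_functions vec_coords"
    using c by (cases rule: tuple_point_coordsE) (auto intro: vec_coordI poly_functions.const)
qed auto

section \<open>Subspaces spanned by polynomial vectors\<close>

definition polynomial_vector :: "('a \<Rightarrow> complex) set \<Rightarrow> ('a \<Rightarrow> complex ^ 'l) \<Rightarrow> bool" where
  "polynomial_vector C u \<longleftrightarrow> (\<forall>j. (\<lambda>p. u p $ j) \<in> poly_functions C)"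

text \<open>
  Near \<open>p\<^sub>0\<close> the subspaces \<open>D p\<close> are spanned by finitely many polynomial vectors. The vectors may be
  dependent, so that frames of several families can be united into a frame of their sum.
\<close>

definition framed_near ::
    "('a \<Rightarrow> complex) set \<Rightarrow> 'a set \<Rightarrow> ('a \<Rightarrow> (complex ^ 'l) set) \<Rightarrow> 'a \<Rightarrow> bool" where
  "framed_near C X D p\<^sub>0 \<longleftrightarrow>
     (\<exists>h\<in>poly_functions C. \<exists>B. finite B \<and> (\<forall>u\<in>B. polynomial_vector C u) \<and> h p\<^sub>0 \<noteq> 0 \<and>
        (\<forall>p\<in>X. h p \<noteq> 0 \<longrightarrow> D p = vec.span ((\<lambda>u. u p) ` B)))"

lemma framed_nearI:
  assumes "h \<in> poly_functions C" "finite B" "\<And>u. u \<in> B \<Longrightarrow> polynomial_vector C u" "h p\<^sub>0 \<noteq> 0"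
    and "\<And>p. p \<in> X \<Longrightarrow> h p \<noteq> 0 \<Longrightarrow> D p = vec.span ((\<lambda>u. u p) ` B)"
  shows "framed_near C X D p\<^sub>0"
  unfolding framed_near_def using assms by (intro bexI[of _ h] exI[of _ B]) auto

lemma framed_nearE:
  assumes "framed_near C X D p\<^sub>0"
  obtains h B where "h \<in> poly_functions C" "finite B" "\<And>u. u \<in> B \<Longrightarrow> polynomial_vector C u"
    "h p\<^sub>0 \<noteq> 0" "\<And>p. p \<in> X \<Longrightarrow> h p \<noteq> 0 \<Longrightarrow> D p = vec.span ((\<lambda>u. u p) ` B)"
  using assms unfolding framed_near_def by auto

lemma framed_near_empty: "framed_near C X (\<lambda>p. {0}) p\<^sub>0"
  by (rule framed_nearI[of "\<lambda>p. 1" _ "{}"]) (auto intro: poly_functions.const)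

lemma framed_near_Un:
  assumes "framed_near C X D p\<^sub>0" "framed_near C X E p\<^sub>0"
  shows "framed_near C X (\<lambda>p. vec.span (D p \<union> E p)) p\<^sub>0"
proof -
  obtain h B where h: "h \<in> poly_functions C" "finite B" "\<And>u. u \<in> B \<Longrightarrow> polynomial_vector C u"
      "h p\<^sub>0 \<noteq> 0" "\<And>p. p \<in> X \<Longrightarrow> h p \<noteq> 0 \<Longrightarrow> D p = vec.span ((\<lambda>u. u p) ` B)"
    using assms(1) by (rule framed_nearE) blast
  obtain k A where k: "k \<in> poly_functions C" "finite A" "\<And>u. u \<in> A \<Longrightarrow> polynomial_vector C u"
      "k p\<^sub>0 \<noteq> 0" "\<And>p. p \<in> X \<Longrightarrow> k p \<noteq> 0 \<Longrightarrow> E p = vec.span ((\<lambda>u. u p) ` A)"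
    using assms(2) by (rule framed_nearE) blast
  have span: "vec.span (vec.span S \<union> vec.span T) = vec.span (S \<union> T)" for S T :: "(complex ^ 'b) set"
    by (simp add: vec.span_Un vec.span_span)
  have "D p = vec.span ((\<lambda>u. u p) ` B)" "E p = vec.span ((\<lambda>u. u p) ` A)"
    if "p \<in> X" "h p * k p \<noteq> 0" for p
    using that h k by auto
  then have "\<forall>p\<in>X. h p * k p \<noteq> 0 \<longrightarrow> vec.span (D p \<union> E p) = vec.span ((\<lambda>u. u p) ` (B \<union> A))"
    by (simp add: span image_Un)
  moreover have "(\<lambda>p. h p * k p) \<in> poly_functions C"
    using h k by (auto intro: poly_functions.mult)
  ultimately show ?thesis
    using h(2-4) k(2-4) by (intro framed_nearI[of "\<lambda>p. h p * k p" _ "B \<union> A"]) auto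
qed

lemma framed_near_UN_lessThan:
  fixes m :: nat
  assumes "\<And>i. i < m \<Longrightarrow> framed_near C X (D i) p\<^sub>0"
  shows "framed_near C X (\<lambda>p. vec.span (\<Union>i<m. D i p)) p\<^sub>0"
  using assms
proof (induction m)
  case 0
  show ?case by (simp add: framed_near_empty)
next
  case (Suc m)
  have "vec.span (\<Union>i<Suc m. D i p) = vec.span (vec.span (\<Union>i<m. D i p) \<union> D m p)" for p
    by (simp add: lessThan_Suc Un_commute vec.span_Un vec.span_span)
  then show ?case
    using framed_near_Un[OF Suc.IH Suc.prems] Suc.prems by simp
qed

lemma framed_near_pullback:
  assumes "framed_near C X D (\<phi> p\<^sub>0)" "\<phi> ` Y \<subseteq> X"
    and "\<And>c. c \<in> C \<Longrightarrow> (\<lambda>p. c (\<phi> p)) \<in> poly_functions C'"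
  shows "framed_near C' Y (\<lambda>p. D (\<phi> p)) p\<^sub>0"
proof -
  obtain h B where h: "h \<in> poly_functions C" "finite B" "\<And>u. u \<in> B \<Longrightarrow> polynomial_vector C u"
      "h (\<phi> p\<^sub>0) \<noteq> 0" "\<And>p. p \<in> X \<Longrightarrow> h p \<noteq> 0 \<Longrightarrow> D p = vec.span ((\<lambda>u. u p) ` B)"
    using assms(1) by (rule framed_nearE) blast
  let ?B = "(\<lambda>u p. u (\<phi> p)) ` B"
  have "(\<lambda>p. h (\<phi> p)) \<in> poly_functions C'"
    using h(1) assms(3) by (rule poly_functions_compose)
  moreover have "polynomial_vector C' (\<lambda>p. u (\<phi> p))" if "u \<in> B" for u
    unfolding polynomial_vector_def
  proof
    fix j
    have "(\<lambda>p. u p $ j) \<in> poly_functions C"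
      using h(3)[OF that] unfolding polynomial_vector_def by blast
    then show "(\<lambda>p. u (\<phi> p) $ j) \<in> poly_functions C'"
      using poly_functions_compose[where \<phi> = \<phi>, OF _ assms(3)] by blast
  qed
  moreover have "D (\<phi> p) = vec.span ((\<lambda>u. u p) ` ?B)" if "p \<in> Y" "h (\<phi> p) \<noteq> 0" for p
    using h(5)[of "\<phi> p"] assms(2) that by (auto simp: image_image)
  ultimately show ?thesis
    using h(2,4) by (intro framed_nearI[of "\<lambda>p. h (\<phi> p)" _ ?B]) auto
qed

text \<open>
  A basis of \<open>D p\<^sub>0\<close> chosen among the spanning vectors has a nonvanishing minor, and the vectors
  stay independent wherever this polynomial does not vanish. That nearby points are framed
  as well allows the maximum to be taken over framed points only.
\<close>

lemma dim_lower_semicontinuous: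
  fixes D :: "'a \<Rightarrow> (complex ^ 'l) set"
  assumes "framed_near C X D p\<^sub>0" "p\<^sub>0 \<in> X"
  shows "\<exists>f\<in>poly_functions C. f p\<^sub>0 \<noteq> 0 \<and>
    (\<forall>p\<in>X. f p \<noteq> 0 \<longrightarrow> framed_near C X D p \<and> vec.dim (D p\<^sub>0) \<le> vec.dim (D p))"
proof -
  obtain h B where h: "h \<in> poly_functions C" "finite B" "\<And>u. u \<in> B \<Longrightarrow> polynomial_vector C u"
      "h p\<^sub>0 \<noteq> 0" "\<And>p. p \<in> X \<Longrightarrow> h p \<noteq> 0 \<Longrightarrow> D p = vec.span ((\<lambda>u. u p) ` B)"
    using assms(1) by (rule framed_nearE) blast
  let ?S = "(\<lambda>u. u p\<^sub>0) ` B"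
  obtain A where A: "A \<subseteq> ?S" "vec.independent A" "card A = vec.dim (D p\<^sub>0)"
    using vec.basis_exists[of ?S] h(5)[OF assms(2) h(4)] by (metis vec.dim_span)
  define d where "d = card A"
  have "finite A" using A(1) h(2) by (meson finite_imageI finite_subset)
  then obtain a where a: "bij_betw a {..<d} A"
    unfolding d_def lessThan_atLeast0 using ex_bij_betw_nat_finite by blast
  have "\<exists>u. u \<in> B \<and> u p\<^sub>0 = a k" if "k < d" for k
  proof -
    have "a k \<in> ?S" using bij_betwE[OF a] A(1) that by auto
    then show ?thesis by auto
  qed
  then obtain w where w: "\<And>k. k < d \<Longrightarrow> w k \<in> B \<and> w k p\<^sub>0 = a k"
    by metis
  have eq: "(\<lambda>k. w k p\<^sub>0) ` {..<d} = A"
    using bij_betw_imp_surj_on[OF a] w by (auto cong: image_cong_simp)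
  moreover have "inj_on (\<lambda>k. w k p\<^sub>0) {..<d}"
    using bij_betw_imp_inj_on[OF a] w unfolding inj_on_def by simp
  ultimately obtain i where i: "plucker d (\<lambda>k. w k p\<^sub>0) i \<noteq> 0"
    using independent_imp_plucker_nonzero[of "\<lambda>k. w k p\<^sub>0" d] A(2) by metis
  let ?f = "\<lambda>p. h p * plucker d (\<lambda>k. w k p) i"
  have "(\<lambda>p. w k p $ j) \<in> poly_functions C" if "k < d" for k j
    using h(3)[of "w k"] w[OF that] unfolding polynomial_vector_def by simp
  then have "?f \<in> poly_functions C"
    by (intro poly_functions.mult poly_functions_plucker h(1))
  moreover have "framed_near C X D p \<and> vec.dim (D p\<^sub>0) \<le> vec.dim (D p)"
    if p: "p \<in> X" "?f p \<noteq> 0" for p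
  proof
    show "framed_near C X D p"
      using p by (intro framed_nearI[OF h(1-3) _ h(5)]) auto
    have "d = vec.dim ((\<lambda>k. w k p) ` {..<d})"
      using span_minor_vec(2)[of d "\<lambda>k. w k p"] p by auto
    also have "\<dots> \<le> vec.dim ((\<lambda>u. u p) ` B)"
      using w by (intro vec.dim_subset) auto
    also have "\<dots> = vec.dim (D p)"
      using h(5)[of p] p by (simp add: vec.dim_span)
    finally show "vec.dim (D p\<^sub>0) \<le> vec.dim (D p)"
      using A(3) d_def by simp
  qed
  ultimately show ?thesis
    using h(4) i by (intro bexI[of _ ?f] conjI ballI impI) simp_all
qed

text \<open>
  The dimension is bounded. Near a framed point where it is maximal it can only increase, hence it
  is constant there.
\<close>

lemma generic_dim_constant:
  fixes D :: "'a \<Rightarrow> (complex ^ 'l) set"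
  assumes "p\<^sub>0 \<in> X" "framed_near C X D p\<^sub>0"
  shows "\<exists>d. generic_on C X (\<lambda>p. vec.dim (D p) = d)"
proof -
  let ?Y = "{p \<in> X. framed_near C X D p}"
  have "vec.dim (D p) \<le> CARD('l)" for p
    by (rule dim_subset_UNIV_cart_gen)
  then obtain p\<^sub>1 where p\<^sub>1: "p\<^sub>1 \<in> ?Y" "\<And>p. p \<in> ?Y \<Longrightarrow> vec.dim (D p) \<le> vec.dim (D p\<^sub>1)"
    using assms ex_has_greatest_nat[of "\<lambda>p. p \<in> ?Y" p\<^sub>0 "\<lambda>p. vec.dim (D p)" "Suc CARD('l)"]
    by (auto simp: less_Suc_eq_le)
  obtain f where "f \<in> poly_functions C" "f p\<^sub>1 \<noteq> 0"
     "\<forall>p\<in>X. f p \<noteq> 0 \<longrightarrow> framed_near C X D p \<and> vec.dim (D p\<^sub>1) \<le> vec.dim (D p)"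
    using dim_lower_semicontinuous[of C X D p\<^sub>1] p\<^sub>1(1) by blast
  then show ?thesis
    using p\<^sub>1 unfolding generic_on_def
    by (intro exI[of _ "vec.dim (D p\<^sub>1)"] bexI[of _ f]) (auto intro: antisym)
qed

text \<open>
  Choose a Pluecker coordinate that does not vanish at \<open>x\<^sub>0\<close>. Where it is nonzero, the vectors
  \<open>minor_vec\<close> belonging to it span \<open>T (proj_pt x)\<close>, and their entries are again Pluecker coordinates,
  given by the polynomials \<open>F\<close>.
\<close>

lemma algebraic_map_framed:
  fixes V :: "(complex ^ 'n) set" and T :: "(complex ^ 'n) set \<Rightarrow> (complex ^ 'l) set"
  assumes "algebraic_map_Gr V N T" "x\<^sub>0 \<in> V" "x\<^sub>0 \<noteq> 0"
  shows "framed_near vec_coords V (\<lambda>x. T (proj_pt x)) x\<^sub>0"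
proof -
  have "proj_pt x\<^sub>0 \<in> proj V"
    using assms(2,3) unfolding proj_def by blast
  then obtain S d F where S: "openin (subtopology proj_zariski (proj V)) S" "proj_pt x\<^sub>0 \<in> S"
    and F: "\<forall>i \<in> {..<N} \<rightarrow>\<^sub>E UNIV. homogeneous_poly d (F i)"
    and pl: "\<And>x. x \<noteq> 0 \<Longrightarrow> proj_pt x \<in> S \<Longrightarrow> plucker_point N (T (proj_pt x)) (\<lambda>i. F i x)"
    using assms(1) unfolding algebraic_map_Gr_def by metis
  obtain K where K: "\<forall>f\<in>K. \<exists>d. homogeneous_poly d f"
    and SK: "S = (proj UNIV - proj_pt ` {x. x \<noteq> 0 \<and> (\<forall>f\<in>K. f x = 0)}) \<inter> proj V"
    using S(1) unfolding openin_subtopology openin_proj_zariski by blast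
  obtain f e where f: "f \<in> K" "f x\<^sub>0 \<noteq> 0" "homogeneous_poly e f"
    using S(2) assms(3) K unfolding SK by blast
  obtain j where j: "x\<^sub>0 $ j \<noteq> 0"
    using assms(3) by (auto simp: vec_eq_iff)
  have inS: "x \<noteq> 0 \<and> proj_pt x \<in> S" if "x \<in> V" "f x \<noteq> 0" "x $ j \<noteq> 0" for x
  proof -
    have "x \<noteq> 0" using that by auto
    moreover have "f y \<noteq> 0" if "proj_pt x = proj_pt y" for y
      using proj_pt_eqD[OF that] homogeneous_poly_scale[OF f(3)] \<open>f x \<noteq> 0\<close> by fastforce
    ultimately show ?thesis
      using \<open>x \<in> V\<close> f(1) unfolding SK proj_def by blast
  qed
  obtain w c where w: "basis_of N w (T (proj_pt x\<^sub>0))" "c \<noteq> 0"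
      "\<forall>i \<in> {..<N} \<rightarrow>\<^sub>E UNIV. F i x\<^sub>0 = c * plucker N w i"
    using pl[OF assms(3) S(2)] unfolding plucker_point_def by blast
  obtain i' where "plucker N w i' \<noteq> 0"
    using independent_imp_plucker_nonzero w(1) unfolding basis_of_def by blast
  \<comment> \<open>Pluecker coordinates are indexed by extensional tuples; a minor only sees the first \<open>N\<close> entries.\<close>
  then obtain i where i: "i \<in> {..<N} \<rightarrow>\<^sub>E UNIV" "plucker N w i \<noteq> 0"
    using plucker_cong[of N "restrict i' {..<N}" i' w] by (intro that[of "restrict i' {..<N}"]) auto
  have upd: "i(k := a) \<in> {..<N} \<rightarrow>\<^sub>E UNIV" if "k < N" for k a
    using i(1) that by (auto simp: PiE_def extensional_def)
  define u where "u k x = (\<chi> a. F (i(k := a)) x)" for k x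
  \<comment> \<open>The factors keep \<open>x\<close> in the domain \<open>S\<close> of \<open>F\<close>, away from \<open>0\<close>, and in the chart of the coordinate \<open>i\<close>.\<close>
  let ?h = "\<lambda>x. f x * x $ j * F i x"
  have "?h \<in> poly_functions vec_coords"
    by (intro poly_functions.mult vec_coordI poly_functions_homogeneous[OF f(3)]
        poly_functions_homogeneous[OF bspec[OF F i(1)]])
  moreover have "polynomial_vector vec_coords (u k)" if "k < N" for k
    unfolding polynomial_vector_def u_def
    using poly_functions_homogeneous[OF bspec[OF F upd[OF that]]] by simp
  moreover have "?h x\<^sub>0 \<noteq> 0"
    using f j i w by simp
  moreover have "T (proj_pt x) = vec.span ((\<lambda>v. v x) ` u ` {..<N})" if x: "x \<in> V" "?h x \<noteq> 0" for x
  proof -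
    obtain w c where w: "basis_of N w (T (proj_pt x))" "c \<noteq> 0"
        "\<forall>i \<in> {..<N} \<rightarrow>\<^sub>E UNIV. F i x = c * plucker N w i"
      using pl[of x] inS[OF x(1)] x(2) unfolding plucker_point_def by auto
    have "T (proj_pt x) = vec.span (minor_vec N w i ` {..<N})"
      using span_minor_vec(1)[of N w i] x(2) bspec[OF w(3) i(1)] w(1) unfolding basis_of_def by simp
    also have "\<dots> = vec.span ((\<lambda>v. c *s v) ` minor_vec N w i ` {..<N})"
      using w(2) by (subst vec.span_image_scale) auto
    also have "(\<lambda>v. c *s v) ` minor_vec N w i ` {..<N} = (\<lambda>v. v x) ` u ` {..<N}"
      unfolding image_image
    proof (rule image_cong)
      fix k assume "k \<in> {..<N}"
      then show "c *s minor_vec N w i k = u k x"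
        using bspec[OF w(3) upd[of k]] by (simp add: u_def minor_vec_def vec_eq_iff)
    qed simp
    finally show ?thesis .
  qed
  ultimately show ?thesis
    by (intro framed_nearI[of ?h _ "u ` {..<N}"]) (simp_all, blast)
qed

section \<open>The generic intersection and generic vectors\<close>

locale algebraic_families =
  fixes V :: "(complex ^ 'n) set" and V' :: "(complex ^ 'k) set"
    and T :: "(complex ^ 'n) set \<Rightarrow> (complex ^ 'l) set"
    and U :: "(complex ^ 'k) set \<Rightarrow> (complex ^ 'l) set"
    and N N' :: nat
  assumes irreducible: "irreducible_on vec_coords V" "irreducible_on vec_coords V'"
    and nonzero: "\<exists>x\<in>V. x \<noteq> 0" "\<exists>y\<in>V'. y \<noteq> 0"
    and algebraic: "algebraic_map_Gr V N T" "algebraic_map_Gr V' N' U"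
begin

abbreviation tuples :: "nat \<Rightarrow> (nat \<Rightarrow> complex ^ 'n) set" where
  "tuples m \<equiv> {..<m} \<rightarrow>\<^sub>E V"

abbreviation tuple_points :: "nat \<Rightarrow> ((nat \<Rightarrow> complex ^ 'n) \<times> (complex ^ 'k)) set" where
  "tuple_points m \<equiv> tuples m \<times> V'"

text \<open>
  The predicate whose generic truth defines \<open>generic_dim\<close>.
\<close>

definition meets_in_dim :: "nat \<Rightarrow> nat \<Rightarrow> (nat \<Rightarrow> complex ^ 'n) \<times> (complex ^ 'k) \<Rightarrow> bool" where
  "meets_in_dim m a = (\<lambda>(x, y). (\<forall>i<m. x i \<noteq> 0) \<and> y \<noteq> 0 \<and>
                  vec.dim (span_of_tuple m T x \<inter> U (proj_pt y)) = a)"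

lemma subspace_U: "y \<in> V' \<Longrightarrow> y \<noteq> 0 \<Longrightarrow> vec.subspace (U (proj_pt y)) \<and> vec.dim (U (proj_pt y)) = N'"
  using algebraic(2) unfolding algebraic_map_Gr_def proj_def Gr_def by blast

lemma tuple_point_mem: "p \<in> tuple_points m \<Longrightarrow> i < m \<Longrightarrow> fst p i \<in> V"
  using PiE_mem[of "fst p" "{..<m}" "\<lambda>_. V" i] by (simp add: mem_Times_iff)

lemma restrict_tuple_point:
  "(\<And>i. i < m \<Longrightarrow> x i \<in> V) \<Longrightarrow> y \<in> V' \<Longrightarrow> (\<lambda>i\<in>{..<m}. x i, y) \<in> tuple_points m"
  by (simp add: restrict_PiE_iff)

lemma tuple_point_undefined: "p \<in> tuple_points m \<Longrightarrow> \<not> i < m \<Longrightarrow> fst p i = undefined"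
  using PiE_arb[of "fst p" "{..<m}" "\<lambda>_. V" i] by (simp add: mem_Times_iff)

lemma subspace_span_of_tuple: "vec.subspace (span_of_tuple m T x)"
  unfolding span_of_tuple_def by (rule vec.subspace_span)

lemma irreducible_tuple_points: "irreducible_on (tuple_point_coords m) (tuple_points m)"
  by (rule irreducible_on_tuple_points[OF irreducible])

lemma framed_near_tuple_point:
  assumes "p \<in> tuple_points m" "\<forall>i<m. fst p i \<noteq> 0" "snd p \<noteq> 0"
  shows "framed_near (tuple_point_coords m) (tuple_points m) (\<lambda>p. span_of_tuple m T (fst p)) p"
    and "framed_near (tuple_point_coords m) (tuple_points m) (\<lambda>p. U (proj_pt (snd p))) p"
proof -
  have "framed_near (tuple_point_coords m) (tuple_points m) (\<lambda>p. T (proj_pt (fst p i))) p" if "i < m" for i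
  proof (rule framed_near_pullback[where \<phi> = "\<lambda>p. fst p i" and X = V and C = vec_coords])
    show "framed_near vec_coords V (\<lambda>x. T (proj_pt x)) (fst p i)"
      using assms that tuple_point_mem by (intro algebraic_map_framed[OF algebraic(1)]) auto
    show "(\<lambda>p. fst p i) ` tuple_points m \<subseteq> V"
    proof (rule image_subsetI)
      fix p assume "p \<in> tuple_points m"
      then show "fst p i \<in> V" by (rule tuple_point_mem[OF _ that])
    qed
    fix c :: "complex ^ 'n \<Rightarrow> complex"
    assume "c \<in> vec_coords"
    then obtain j where "c = (\<lambda>x. x $ j)" by (auto simp: vec_coords_def)
    then show "(\<lambda>p. c (fst p i)) \<in> poly_functions (tuple_point_coords m)"
      by (simp add: tuple_point_coordI(1)[OF that])
  qed
  then show "framed_near (tuple_point_coords m) (tuple_points m) (\<lambda>p. span_of_tuple m T (fst p)) p"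
    unfolding span_of_tuple_def by (rule framed_near_UN_lessThan)
  show "framed_near (tuple_point_coords m) (tuple_points m) (\<lambda>p. U (proj_pt (snd p))) p"
  proof (rule framed_near_pullback[where \<phi> = snd and X = V' and C = vec_coords])
    show "framed_near vec_coords V' (\<lambda>x. U (proj_pt x)) (snd p)"
      using assms by (intro algebraic_map_framed[OF algebraic(2)]) auto
    fix c :: "complex ^ 'k \<Rightarrow> complex"
    assume "c \<in> vec_coords"
    then obtain j where "c = (\<lambda>x. x $ j)" by (auto simp: vec_coords_def)
    then show "(\<lambda>p. c (snd p)) \<in> poly_functions (tuple_point_coords m)"
      by (simp add: tuple_point_coordI(2))
  qed auto
qed

lemma generic_nonzero:
  "generic_on (tuple_point_coords m) (tuple_points m) (\<lambda>p. (\<forall>i<m. fst p i \<noteq> 0) \<and> snd p \<noteq> 0)"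
proof -
  obtain v w where v: "v \<in> V" "v \<noteq> 0" and w: "w \<in> V'" "w \<noteq> 0"
    using nonzero by blast
  then obtain j j' where j: "v $ j \<noteq> 0" "w $ j' \<noteq> 0"
    by (auto simp: vec_eq_iff)
  let ?f = "\<lambda>p :: (nat \<Rightarrow> complex ^ 'n) \<times> (complex ^ 'k). (\<Prod>i<m. fst p i $ j) * snd p $ j'"
  have "?f \<in> poly_functions (tuple_point_coords m)"
    by (intro poly_functions.mult poly_functions_prod tuple_point_coordI) simp
  moreover have "(\<lambda>i\<in>{..<m}. v, w) \<in> tuple_points m" "?f (\<lambda>i\<in>{..<m}. v, w) \<noteq> 0"
    using v w j by auto
  moreover have "(\<forall>i<m. fst p i \<noteq> 0) \<and> snd p \<noteq> 0" if "?f p \<noteq> 0" for p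
    using that by auto (metis lessThan_iff zero_index)
  ultimately show ?thesis
    unfolding generic_on_def by (intro bexI[of _ ?f] conjI bexI[of _ "(\<lambda>i\<in>{..<m}. v, w)"]) simp_all
qed

text \<open>
  The description in \<open>generic_dim\<close> is meaningful: the dimensions of the span and of its sum with
  \<open>U y\<close> are generically constant, and so is the dimension of the intersection, by the dimension
  formula. Uniqueness holds because two generic conditions have a common point.
\<close>

lemma ex1_generic_dim: "\<exists>!a. generic_on (tuple_point_coords m) (tuple_points m) (meets_in_dim m a)"
proof (rule ex_ex1I)
  let ?C = "tuple_point_coords m :: ((nat \<Rightarrow> complex ^ 'n) \<times> (complex ^ 'k) \<Rightarrow> complex) set"
  let ?S = "\<lambda>p. span_of_tuple m T (fst p)" and ?U = "\<lambda>p. U (proj_pt (snd p))"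
  obtain p where p: "p \<in> tuple_points m" "\<forall>i<m. fst p i \<noteq> 0" "snd p \<noteq> 0"
    using generic_on_ex[OF generic_nonzero] by blast
  note frames = framed_near_tuple_point[OF p]
  obtain s where s: "generic_on ?C (tuple_points m) (\<lambda>p. vec.dim (?S p) = s)"
    using generic_dim_constant[OF p(1) frames(1)] by blast
  obtain t where t: "generic_on ?C (tuple_points m) (\<lambda>p. vec.dim (vec.span (?S p \<union> ?U p)) = t)"
    using generic_dim_constant[OF p(1) framed_near_Un[OF frames]] by blast
  have "generic_on ?C (tuple_points m) (\<lambda>p. ((\<forall>i<m. fst p i \<noteq> 0) \<and> snd p \<noteq> 0) \<and>
      vec.dim (?S p) = s \<and> vec.dim (vec.span (?S p \<union> ?U p)) = t)"
    by (rule generic_on_conj[OF irreducible_tuple_points generic_nonzero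
          generic_on_conj[OF irreducible_tuple_points s t]])
  then have "generic_on ?C (tuple_points m) (meets_in_dim m (s + N' - t))"
  proof (rule generic_on_mono)
    fix p assume p: "p \<in> tuple_points m" "((\<forall>i<m. fst p i \<noteq> 0) \<and> snd p \<noteq> 0) \<and>
      vec.dim (?S p) = s \<and> vec.dim (vec.span (?S p \<union> ?U p)) = t"
    then have U: "vec.subspace (?U p)" "vec.dim (?U p) = N'"
      using subspace_U[of "snd p"] by auto
    have "vec.span (?S p \<union> ?U p) = {a + b |a b. a \<in> ?S p \<and> b \<in> ?U p}"
      unfolding vec.span_Un vec.span_eq_iff[THEN iffD2, OF U(1)]
        vec.span_eq_iff[THEN iffD2, OF subspace_span_of_tuple] ..
    then have "t + vec.dim (?S p \<inter> ?U p) = s + N'"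
      using vec.dim_sums_Int[OF subspace_span_of_tuple[of m "fst p"] U(1)] p(2) U(2) by simp
    then show "meets_in_dim m (s + N' - t) p"
      using p(2) by (auto simp: meets_in_dim_def split_beta)
  qed
  then show "\<exists>a. generic_on ?C (tuple_points m) (meets_in_dim m a)" ..
  fix a b
  assume "generic_on ?C (tuple_points m) (meets_in_dim m a)" "generic_on ?C (tuple_points m) (meets_in_dim m b)"
  then obtain p where "meets_in_dim m a p \<and> meets_in_dim m b p"
    using generic_on_ex[OF generic_on_conj[OF irreducible_tuple_points]] by blast
  then show "a = b" by (auto simp: meets_in_dim_def)
qed

lemma generic_dim_eq_THE:
  "generic_dim V V' T U m = (THE a. generic_on (tuple_point_coords m) (tuple_points m) (meets_in_dim m a))"
  unfolding generic_dim_def power_prod_space_def generically_iff_generic_on meets_in_dim_def ..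

lemma generic_meets_in_dim:
  "generic_on (tuple_point_coords m) (tuple_points m) (meets_in_dim m (generic_dim V V' T U m))"
  unfolding generic_dim_eq_THE by (rule theI'[OF ex1_generic_dim])

lemma generic_dim_eqI:
  "generic_on (tuple_point_coords m) (tuple_points m) (meets_in_dim m a) \<Longrightarrow> generic_dim V V' T U m = a"
  unfolding generic_dim_eq_THE by (rule the1_equality[OF ex1_generic_dim])

definition window ::
    "nat \<Rightarrow> nat \<Rightarrow> (nat \<Rightarrow> complex ^ 'n) \<times> (complex ^ 'k) \<Rightarrow> (nat \<Rightarrow> complex ^ 'n) \<times> (complex ^ 'k)" where
  "window j r z = (\<lambda>i\<in>{..<r}. fst z (i + j), snd z)"

lemma window_image:
  assumes "j + r \<le> M"
  shows "window j r ` tuple_points M = tuple_points r"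
proof (intro subset_antisym subsetI)
  fix p assume "p \<in> window j r ` tuple_points M"
  then obtain z where z: "z \<in> tuple_points M" "p = window j r z" by blast
  show "p \<in> tuple_points r"
    unfolding z(2) window_def
  proof (rule restrict_tuple_point)
    fix i assume "i < r"
    then show "fst z (i + j) \<in> V"
      using assms by (intro tuple_point_mem[OF z(1)]) simp
  qed (use z(1) in \<open>simp add: mem_Times_iff\<close>)
next
  fix p assume p: "p \<in> tuple_points r"
  obtain v where v: "v \<in> V" using nonzero(1) by blast
  \<comment> \<open>Positions outside the window are filled with an arbitrary point of \<open>V\<close>.\<close>
  let ?z = "(\<lambda>i\<in>{..<M}. if i \<in> {j..<j + r} then fst p (i - j) else v, snd p)"
  have "?z \<in> tuple_points M"
  proof (rule restrict_tuple_point)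
    fix i assume "i < M"
    show "(if i \<in> {j..<j + r} then fst p (i - j) else v) \<in> V"
      using v tuple_point_mem[OF p, of "i - j"] by auto
  qed (use p in \<open>simp add: mem_Times_iff\<close>)
  moreover have "fst (window j r ?z) i = fst p i" for i
    using tuple_point_undefined[OF p, of i] assms by (cases "i < r") (auto simp: window_def)
  then have "window j r ?z = p"
    by (simp add: window_def prod_eq_iff fun_eq_iff)
  ultimately show "p \<in> window j r ` tuple_points M"
    by (intro image_eqI[of _ _ ?z]) simp_all
qed

lemma generic_on_window:
  assumes "j + r \<le> M" "generic_on (tuple_point_coords r) (tuple_points r) P"
  shows "generic_on (tuple_point_coords M) (tuple_points M) (\<lambda>z. P (window j r z))"
proof (rule generic_on_pullback[OF assms(2) window_image[OF assms(1)]])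
  fix c :: "(nat \<Rightarrow> complex ^ 'n) \<times> (complex ^ 'k) \<Rightarrow> complex"
  assume "c \<in> tuple_point_coords r"
  then show "(\<lambda>z. c (window j r z)) \<in> poly_functions (tuple_point_coords M)"
  proof (cases rule: tuple_point_coordsE)
    case (1 i b)
    then show ?thesis
      using assms(1) tuple_point_coordI(1)[of "i + j" M b] by (simp add: window_def)
  next
    case (2 b)
    then show ?thesis
      using tuple_point_coordI(2)[of b M] by (simp add: window_def)
  qed
qed

lemma span_window:
  "span_of_tuple r T (fst (window j r z)) = vec.span (\<Union>k\<in>{j..<j + r}. T (proj_pt (fst z k)))"
proof -
  have "{j..<j + r} = (\<lambda>i. i + j) ` {..<r}"
    by (simp add: lessThan_atLeast0 add.commute)
  then show ?thesis
    unfolding span_of_tuple_def by (simp add: window_def)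
qed

text \<open>
  The subspace \<open>M\<close> of the introduction.
\<close>

definition generic_vectors :: "nat \<Rightarrow> (complex ^ 'l) set" where
  "generic_vectors m = {v. generic_on (tuple_coords m) (tuples m)
     (\<lambda>x. (\<forall>i<m. x i \<noteq> 0) \<and> v \<in> span_of_tuple m T x)}"

text \<open>
  The windows at \<open>j\<close> and \<open>j + 1\<close> both lie in the longer window at \<open>j\<close>, whose span meets \<open>U y\<close> in
  the same dimension; so the three intersections coincide.
\<close>

lemma shifted_windows_same_intersection:
  assumes z: "z \<in> tuple_points (2 * m)"
    and S: "\<And>j. j \<le> m \<Longrightarrow> meets_in_dim m a (window j m z)"
    and W: "\<And>j. j < m \<Longrightarrow> meets_in_dim (m + 1) a (window j (m + 1) z)"
    and "j \<le> m"
  shows "span_of_tuple m T (fst (window j m z)) \<inter> U (proj_pt (snd z))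
       = span_of_tuple m T (fst (window 0 m z)) \<inter> U (proj_pt (snd z))"
  using \<open>j \<le> m\<close>
proof (induction j)
  case 0
  show ?case ..
next
  case (Suc j)
  let ?U = "U (proj_pt (snd z))"
  have U: "vec.subspace ?U"
    using S[of 0] subspace_U[of "snd z"] z by (auto simp: meets_in_dim_def window_def)
  let ?S = "\<lambda>j. span_of_tuple m T (fst (window j m z)) \<inter> ?U"
  let ?W = "span_of_tuple (m + 1) T (fst (window j (m + 1) z)) \<inter> ?U"
  have eq: "?S j' = ?W" if j': "j' = j \<or> j' = Suc j" for j'
  proof (rule vec.subspace_dim_equal)
    show "vec.subspace (?S j')" "vec.subspace ?W"
      by (intro vec.subspace_inter subspace_span_of_tuple U)+
    show "?S j' \<subseteq> ?W"
      unfolding span_window using j' by (intro Int_mono vec.span_mono UN_mono) auto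
    show "vec.dim ?W \<le> vec.dim (?S j')"
      using S[of j'] W[of j] j' Suc.prems by (auto simp: meets_in_dim_def window_def)
  qed
  show ?case
    using eq[of j] eq[of "Suc j"] Suc by simp
qed

text \<open>
  All windows of a generic tuple of length \<open>2m\<close> are generic, as there are finitely many of them. Fix
  the first half and \<open>y\<close>, and vary the second half, which remains generic because the condition
  is a polynomial that is nonzero for the original second half. The last window is the second
  half itself.
\<close>

lemma generic_intersection_subset_generic_vectors:
  assumes "generic_dim V V' T U (m + 1) = generic_dim V V' T U m"
  shows "\<exists>p. meets_in_dim m (generic_dim V V' T U m) p \<and>
    span_of_tuple m T (fst p) \<inter> U (proj_pt (snd p)) \<subseteq> generic_vectors m"
proof -
  let ?a = "generic_dim V V' T U m"
  let ?Q = "\<lambda>z. (\<forall>j\<in>{..m}. meets_in_dim m ?a (window j m z)) \<and>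
                (\<forall>j\<in>{..<m}. meets_in_dim (m + 1) ?a (window j (m + 1) z))"
  have "generic_on (tuple_point_coords (2 * m)) (tuple_points (2 * m)) ?Q"
  proof (rule generic_on_conj[OF irreducible_tuple_points]; rule generic_on_ball[OF irreducible_tuple_points])
    fix j assume "j \<in> {..m}"
    then show "generic_on (tuple_point_coords (2 * m)) (tuple_points (2 * m))
        (\<lambda>z. meets_in_dim m ?a (window j m z))"
      by (intro generic_on_window[OF _ generic_meets_in_dim]) simp
  next
    fix j assume "j \<in> {..<m}"
    then show "generic_on (tuple_point_coords (2 * m)) (tuple_points (2 * m))
        (\<lambda>z. meets_in_dim (m + 1) ?a (window j (m + 1) z))"
      using generic_on_window[where j = j, OF _ generic_meets_in_dim[of "m + 1"]] assms by simp
  qed simp_all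
  then obtain f z where f: "f \<in> poly_functions (tuple_point_coords (2 * m))"
    and z: "z \<in> tuple_points (2 * m)" "f z \<noteq> 0"
    and Q: "\<And>z. z \<in> tuple_points (2 * m) \<Longrightarrow> f z \<noteq> 0 \<Longrightarrow> ?Q z"
    unfolding generic_on_def by auto
  \<comment> \<open>Replaces the second half of \<open>z\<close> by \<open>x\<close>.\<close>
  define append where
    "append x = (\<lambda>k\<in>{..<2 * m}. if k < m then fst z k else x (k - m), snd z)" for x
  have snd_z: "snd z \<in> V'" using z(1) by (simp add: mem_Times_iff)
  have append_mem: "append x \<in> tuple_points (2 * m)" if "x \<in> tuples m" for x
    unfolding append_def
  proof (rule restrict_tuple_point[OF _ snd_z])
    fix k assume "k < 2 * m"
    then show "(if k < m then fst z k else x (k - m)) \<in> V"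
      using tuple_point_mem[OF z(1), of k] PiE_mem[OF that, of "k - m"] by auto
  qed
  have first: "window 0 m (append x) = window 0 m z" for x
    by (auto simp: window_def append_def fun_eq_iff)
  have last: "window m m (append x) = (x, snd z)" if "x \<in> tuples m" for x
    using PiE_arb[OF that] by (auto simp: window_def append_def fun_eq_iff)
  have "(\<lambda>x. f (append x)) \<in> poly_functions (tuple_coords m)"
    using f
  proof (rule poly_functions_compose)
    fix c :: "(nat \<Rightarrow> complex ^ 'n) \<times> (complex ^ 'k) \<Rightarrow> complex"
    assume "c \<in> tuple_point_coords (2 * m)"
    then show "(\<lambda>x. c (append x)) \<in> poly_functions (tuple_coords m)"
    proof (cases rule: tuple_point_coordsE)
      case (1 i b)
      then show ?thesis
        by (cases "i < m") (auto simp: append_def intro: poly_functions.const tuple_coordI)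
    next
      case (2 b)
      then show ?thesis by (simp add: append_def poly_functions.const)
    qed
  qed
  moreover have "fst (window m m z) \<in> tuples m"
  proof -
    have "window m m z \<in> tuple_points m"
      using imageI[OF z(1), of "window m m"] window_image[of m m "2 * m"] by simp
    then show ?thesis by (simp add: mem_Times_iff)
  qed
  moreover have "append (fst (window m m z)) = z"
    using tuple_point_undefined[OF z(1)] by (auto simp: append_def window_def fun_eq_iff prod_eq_iff)
  ultimately have generic: "generic_on (tuple_coords m) (tuples m) (\<lambda>x. f (append x) \<noteq> 0)"
    unfolding generic_on_def using z(2)
    by (intro bexI[of _ "\<lambda>x. f (append x)"] conjI bexI[of _ "fst (window m m z)"]) simp_all
  let ?p = "window 0 m z"
  have "span_of_tuple m T (fst ?p) \<inter> U (proj_pt (snd ?p)) \<subseteq> generic_vectors m"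
  proof
    fix v assume v: "v \<in> span_of_tuple m T (fst ?p) \<inter> U (proj_pt (snd ?p))"
    have "generic_on (tuple_coords m) (tuples m)
      (\<lambda>x. (\<forall>i<m. x i \<noteq> 0) \<and> v \<in> span_of_tuple m T x)"
      using generic
    proof (rule generic_on_mono)
      fix x assume x: "x \<in> tuples m" "f (append x) \<noteq> 0"
      have S: "meets_in_dim m ?a (window j m (append x))" if "j \<le> m" for j
        using conjunct1[OF Q[OF append_mem[OF x(1)] x(2)]] that by simp
      have W: "meets_in_dim (m + 1) ?a (window j (m + 1) (append x))" if "j < m" for j
        using conjunct2[OF Q[OF append_mem[OF x(1)] x(2)]] that by simp
      have snd: "snd (append x) = snd z" by (simp add: append_def)
      have same: "span_of_tuple m T x \<inter> U (proj_pt (snd z)) = span_of_tuple m T (fst ?p) \<inter> U (proj_pt (snd z))"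
        using shifted_windows_same_intersection[OF append_mem[OF x(1)] S W order_refl]
        unfolding first last[OF x(1)] snd fst_conv by simp
      have "v \<in> span_of_tuple m T (fst ?p) \<inter> U (proj_pt (snd z))"
        using v by (simp add: window_def)
      then have "v \<in> span_of_tuple m T x"
        unfolding same[symmetric] by (rule IntD1)
      moreover have "meets_in_dim m ?a (x, snd z)"
        using S[OF order_refl] last[OF x(1)] by simp
      ultimately show "(\<forall>i<m. x i \<noteq> 0) \<and> v \<in> span_of_tuple m T x"
        by (simp add: meets_in_dim_def)
    qed
    then show "v \<in> generic_vectors m" by (simp add: generic_vectors_def)
  qed
  moreover have "meets_in_dim m ?a ?p"
    using conjunct1[OF Q[OF z]] by simp
  ultimately show ?thesis by (intro exI[of _ ?p] conjI)
qed

lemma irreducible_tuples: "irreducible_on (tuple_coords m) (tuples m)"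
  by (rule irreducible_on_tuples[OF irreducible(1)])

lemma generic_nonzero_tuple: "generic_on (tuple_coords m) (tuples m) (\<lambda>x. \<forall>i<m. x i \<noteq> 0)"
proof -
  obtain v where v: "v \<in> V" "v \<noteq> 0"
    using nonzero by blast
  then obtain j where j: "v $ j \<noteq> 0"
    by (auto simp: vec_eq_iff)
  let ?f = "\<lambda>x :: nat \<Rightarrow> complex ^ 'n. \<Prod>i<m. x i $ j"
  have "?f \<in> poly_functions (tuple_coords m)"
    by (intro poly_functions_prod tuple_coordI) simp
  moreover have "(\<lambda>i\<in>{..<m}. v) \<in> tuples m" "?f (\<lambda>i\<in>{..<m}. v) \<noteq> 0"
    using v j by auto
  moreover have "\<forall>i<m. x i \<noteq> 0" if "?f x \<noteq> 0" for x
    using that by auto (metis lessThan_iff zero_index)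
  ultimately show ?thesis
    unfolding generic_on_def by (intro bexI[of _ ?f] conjI bexI[of _ "\<lambda>i\<in>{..<m}. v"]) simp_all
qed

lemma subspace_generic_vectors: "vec.subspace (generic_vectors m)"
proof (rule vec.subspaceI)
  show "0 \<in> generic_vectors m"
    unfolding generic_vectors_def
    using generic_on_mono[OF generic_nonzero_tuple] vec.subspace_0[OF subspace_span_of_tuple] by simp
next
  fix v w assume "v \<in> generic_vectors m" "w \<in> generic_vectors m"
  then have "generic_on (tuple_coords m) (tuples m) (\<lambda>x. ((\<forall>i<m. x i \<noteq> 0) \<and> v \<in> span_of_tuple m T x) \<and>
      ((\<forall>i<m. x i \<noteq> 0) \<and> w \<in> span_of_tuple m T x))"
    unfolding generic_vectors_def mem_Collect_eq by (rule generic_on_conj[OF irreducible_tuples])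
  then show "v + w \<in> generic_vectors m"
    unfolding generic_vectors_def mem_Collect_eq
    by (rule generic_on_mono) (auto intro: vec.subspace_add[OF subspace_span_of_tuple])
next
  fix c v assume "v \<in> generic_vectors m"
  then show "c *s v \<in> generic_vectors m"
    unfolding generic_vectors_def mem_Collect_eq
    by (rule generic_on_mono) (auto intro: vec.subspace_scale[OF subspace_span_of_tuple])
qed

text \<open>
  The generic condition depends on the vector; a basis is finite, so it holds for all basis vectors
  simultaneously.
\<close>

lemma generic_vectors_UNIV_imp_generic_span:
  assumes "generic_vectors m = UNIV"
  shows "generic_on (tuple_coords m) (tuples m) (\<lambda>x. (\<forall>i<m. x i \<noteq> 0) \<and> span_of_tuple m T x = UNIV)"
proof -
  have "generic_on (tuple_coords m) (tuples m)
      (\<lambda>x. (\<forall>i<m. x i \<noteq> 0) \<and> (\<forall>v\<in>cart_basis. (\<forall>i<m. x i \<noteq> 0) \<and> v \<in> span_of_tuple m T x))"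
  proof (rule generic_on_conj[OF irreducible_tuples generic_nonzero_tuple],
      rule generic_on_ball[OF irreducible_tuples finite_cart_basis])
    fix v :: "complex ^ 'l"
    have "v \<in> generic_vectors m" using assms by simp
    then show "generic_on (tuple_coords m) (tuples m) (\<lambda>x. (\<forall>i<m. x i \<noteq> 0) \<and> v \<in> span_of_tuple m T x)"
      unfolding generic_vectors_def mem_Collect_eq .
  qed
  then show ?thesis
  proof (rule generic_on_mono)
    fix x assume x: "(\<forall>i<m. x i \<noteq> 0) \<and> (\<forall>v\<in>cart_basis. (\<forall>i<m. x i \<noteq> 0) \<and> v \<in> span_of_tuple m T x)"
    then have "vec.span cart_basis \<subseteq> span_of_tuple m T x"
      by (intro vec.span_minimal subspace_span_of_tuple) auto
    then show "(\<forall>i<m. x i \<noteq> 0) \<and> span_of_tuple m T x = UNIV"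
      using x by auto
  qed
qed

lemma generic_dim_eq_if_generic_span:
  assumes "generic_on (tuple_coords m) (tuples m) (\<lambda>x. (\<forall>i<m. x i \<noteq> 0) \<and> span_of_tuple m T x = UNIV)"
  shows "generic_dim V V' T U m = N'"
proof (rule generic_dim_eqI)
  have "generic_on (tuple_point_coords m) (tuple_points m)
      (\<lambda>p. (\<forall>i<m. fst p i \<noteq> 0) \<and> span_of_tuple m T (fst p) = UNIV)"
  proof (rule generic_on_pullback[OF assms, where \<phi> = fst])
    show "fst ` tuple_points m = tuples m"
      using nonzero(2) by auto
    fix c :: "(nat \<Rightarrow> complex ^ 'n) \<Rightarrow> complex"
    assume "c \<in> tuple_coords m"
    then obtain i j where "c = (\<lambda>x. x i $ j)" "i < m" by (auto simp: tuple_coords_def)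
    then show "(\<lambda>p. c (fst p)) \<in> poly_functions (tuple_point_coords m)"
      using tuple_point_coordI(1)[of i m j] by simp
  qed
  from generic_on_conj[OF irreducible_tuple_points this generic_nonzero]
  show "generic_on (tuple_point_coords m) (tuple_points m) (meets_in_dim m N')"
  proof (rule generic_on_mono)
    fix p
    assume "p \<in> tuple_points m"
      and "((\<forall>i<m. fst p i \<noteq> 0) \<and> span_of_tuple m T (fst p) = UNIV) \<and> (\<forall>i<m. fst p i \<noteq> 0) \<and> snd p \<noteq> 0"
    then show "meets_in_dim m N' p"
      using subspace_U[of "snd p"] by (simp add: meets_in_dim_def split_beta mem_Times_iff)
  qed
qed

end

section \<open>Irreducible modules\<close>

lemma G_module_linear:
  "G_module G \<rho> \<Longrightarrow> g \<in> carrier G \<Longrightarrow> Vector_Spaces.linear (*s) (*s) (\<rho> g)"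
  unfolding G_module_def by blast

lemma G_module_inverse:
  assumes "G_module G \<rho>" "g \<in> carrier G"
  shows "\<rho> (inv\<^bsub>G\<^esub> g) (\<rho> g x) = x" and "\<rho> g (\<rho> (inv\<^bsub>G\<^esub> g) x) = x"
proof -
  interpret group_action G UNIV \<rho>
    using assms(1) unfolding G_module_def by blast
  interpret G: group G
    using group_hom by (rule group_hom.axioms(1))
  show "\<rho> (inv\<^bsub>G\<^esub> g) (\<rho> g x) = x"
    by (rule orbit_sym_aux[OF assms(2) UNIV_I refl])
  show "\<rho> g (\<rho> (inv\<^bsub>G\<^esub> g) x) = x"
    using orbit_sym_aux[OF G.inv_closed[OF assms(2)] UNIV_I refl] G.inv_inv[OF assms(2)] by simp
qed

lemma linear_image_span:
  "Vector_Spaces.linear (*s) (*s) f \<Longrightarrow> f ` vec.span S = vec.span (f ` S)"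
  for f :: "complex ^ 'n \<Rightarrow> complex ^ 'm"
  by (rule vec.linear_span_image[symmetric])

text \<open>
  Shows that linear maps have polynomial coordinates.
\<close>

lemma linear_eq_matrix_entries:
  fixes f :: "complex ^ 'n \<Rightarrow> complex ^ 'm"
  assumes "Vector_Spaces.linear (*s) (*s) f"
  shows "f x $ j = (\<Sum>b\<in>UNIV. matrix f $ j $ b * x $ b)"
proof -
  have "f x = matrix f *v x"
    by (rule matrix_works[OF assms, symmetric])
  then show ?thesis
    by (simp add: matrix_vector_mult_def)
qed

text \<open>
  Equivariance gives \<open>S x = g S (g\<inverse> x)\<close>. If \<open>v \<in> S x\<close> for generic \<open>x\<close>, then also \<open>v \<in> S (g\<inverse> x)\<close>
  for generic \<open>x\<close>, because \<open>x \<mapsto> g\<inverse> x\<close> is a polynomial bijection of \<open>V\<^sup>m\<close>; hence \<open>g v \<in> S x\<close>.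
\<close>

lemma (in algebraic_families) G_submodule_generic_vectors:
  assumes \<rho>V: "G_module G \<rho>V" and \<rho>L: "G_module G \<rho>L"
    and V: "\<forall>g\<in>carrier G. \<rho>V g ` V \<subseteq> V" and T: "equivariant_Gr G \<rho>V \<rho>L V T"
  shows "G_submodule G \<rho>L (generic_vectors m)"
  unfolding G_submodule_def
proof (intro conjI ballI subspace_generic_vectors image_subsetI)
  fix g v assume g: "g \<in> carrier G" and v: "v \<in> generic_vectors m"
  have group: "group G"
    using \<rho>V unfolding G_module_def by (meson group_action.group_hom group_hom.axioms(1))
  have g': "inv\<^bsub>G\<^esub> g \<in> carrier G"
    by (rule group.inv_closed[OF group g])
  define \<phi> where "\<phi> x = (\<lambda>i\<in>{..<m}. \<rho>V (inv\<^bsub>G\<^esub> g) (x i))" for x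
  have \<phi>_mem: "\<phi> x \<in> tuples m" if "x \<in> tuples m" for x
    using V g' PiE_mem[OF that] by (auto simp: \<phi>_def restrict_PiE_iff image_subset_iff)
  have image: "\<phi> ` tuples m = tuples m"
  proof (intro subset_antisym image_subsetI subsetI)
    fix x assume x: "x \<in> tuples m"
    let ?x = "\<lambda>i\<in>{..<m}. \<rho>V g (x i)"
    have "?x \<in> tuples m"
      using V g PiE_mem[OF x] by (auto simp: restrict_PiE_iff image_subset_iff)
    moreover have "\<phi> ?x = x"
      using PiE_arb[OF x] by (auto simp: \<phi>_def fun_eq_iff G_module_inverse[OF \<rho>V g])
    ultimately show "x \<in> \<phi> ` tuples m"
      by (intro image_eqI[of _ _ ?x]) simp_all
  qed (rule \<phi>_mem)
  have poly: "(\<lambda>x. c (\<phi> x)) \<in> poly_functions (tuple_coords m)" if coord: "c \<in> tuple_coords m"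
    for c :: "(nat \<Rightarrow> complex ^ 'n) \<Rightarrow> complex"
  proof -
    obtain i j where c: "c = (\<lambda>x. x i $ j)" and i: "i < m"
      using coord by (auto simp: tuple_coords_def)
    have "(\<lambda>x. \<Sum>b\<in>UNIV. matrix (\<rho>V (inv\<^bsub>G\<^esub> g)) $ j $ b * x i $ b) \<in> poly_functions (tuple_coords m)"
      by (intro poly_functions_sum poly_functions.mult poly_functions.const tuple_coordI[OF i])
    then show ?thesis
      using i by (simp add: c \<phi>_def linear_eq_matrix_entries[OF G_module_linear[OF \<rho>V g']])
  qed
  have "generic_on (tuple_coords m) (tuples m)
      (\<lambda>x. (\<forall>i<m. \<phi> x i \<noteq> 0) \<and> v \<in> span_of_tuple m T (\<phi> x))"
    using v unfolding generic_vectors_def mem_Collect_eq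
    by (rule generic_on_pullback[where \<phi> = \<phi>, OF _ image poly])
  then have "generic_on (tuple_coords m) (tuples m)
      (\<lambda>x. (\<forall>i<m. x i \<noteq> 0) \<and> \<rho>L g v \<in> span_of_tuple m T x)"
  proof (rule generic_on_mono)
    fix x assume x: "x \<in> tuples m" "(\<forall>i<m. \<phi> x i \<noteq> 0) \<and> v \<in> span_of_tuple m T (\<phi> x)"
    have x_eq: "x i = \<rho>V g (\<phi> x i)" if "i < m" for i
      using that by (simp add: \<phi>_def G_module_inverse[OF \<rho>V g])
    have nz: "x i \<noteq> 0" if "i < m" for i
    proof
      assume "x i = 0"
      then have "\<phi> x i = 0"
        using that vec.linear_0[OF G_module_linear[OF \<rho>V g']] by (simp add: \<phi>_def)
      then show False using x(2) that by blast
    qed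
    have "T (proj_pt (x i)) = \<rho>L g ` T (proj_pt (\<phi> x i))" if i: "i < m" for i
    proof -
      have "proj_pt (\<phi> x i) \<in> proj V"
        unfolding proj_def using x(2) i PiE_mem[OF \<phi>_mem[OF x(1)], of i] by (intro imageI) simp
      moreover have "proj_pt (x i) = \<rho>V g ` proj_pt (\<phi> x i)"
        unfolding proj_pt_def linear_image_span[OF G_module_linear[OF \<rho>V g]]
        using x_eq[OF i] by simp
      ultimately show ?thesis
        using T g unfolding equivariant_Gr_def by simp
    qed
    then have "span_of_tuple m T x = \<rho>L g ` span_of_tuple m T (\<phi> x)"
      unfolding span_of_tuple_def linear_image_span[OF G_module_linear[OF \<rho>L g]] image_UN
      by simp
    then show "(\<forall>i<m. x i \<noteq> 0) \<and> \<rho>L g v \<in> span_of_tuple m T x"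
      using x(2) nz by simp
  qed
  then show "\<rho>L g v \<in> generic_vectors m"
    by (simp add: generic_vectors_def)
qed

theorem lemma3p2:
  fixes G :: "('g, 'r) monoid_scheme"
    and \<rho>L :: "'g \<Rightarrow> complex ^ 'l \<Rightarrow> complex ^ 'l"
    and \<rho>V :: "'g \<Rightarrow> complex ^ 'n \<Rightarrow> complex ^ 'n"
    and \<rho>V' :: "'g \<Rightarrow> complex ^ 'k \<Rightarrow> complex ^ 'k"
    and V :: "(complex ^ 'n) set"
    and V' :: "(complex ^ 'k) set"
    and T :: "(complex ^ 'n) set \<Rightarrow> (complex ^ 'l) set"
    and U :: "(complex ^ 'k) set \<Rightarrow> (complex ^ 'l) set"
    and N N' m :: nat
  assumes "group G"
    and "irreducible_G_module G \<rho>L"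
    and "G_module G \<rho>V" and "G_module G \<rho>V'"
    and "irreducible_affine_cone V" and "irreducible_affine_cone V'"
    and "\<forall>g\<in>carrier G. \<rho>V g ` V \<subseteq> V" and "\<forall>g\<in>carrier G. \<rho>V' g ` V' \<subseteq> V'"
    and "proj V \<noteq> {}" and "proj V' \<noteq> {}"
    and "algebraic_map_Gr V N T" and "equivariant_Gr G \<rho>V \<rho>L V T"
    and "algebraic_map_Gr V' N' U" and "equivariant_Gr G \<rho>V' \<rho>L V' U"
    and "generic_dim V V' T U (m + 1) = generic_dim V V' T U m"
    and "generic_dim V V' T U m \<noteq> 0"
  shows "generically (power_space m V)
           (\<lambda>x. (\<forall>i<m. x i \<noteq> 0) \<and> span_of_tuple m T x = UNIV)
         \<and> generic_dim V V' T U m = N'"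
proof -
  interpret algebraic_families V V' T U N N'
  proof
    show "irreducible_on vec_coords V" "irreducible_on vec_coords V'"
      using assms(5,6) unfolding irreducible_affine_cone_def
      by (auto intro: irreducible_space_imp_irreducible_on)
    show "\<exists>x\<in>V. x \<noteq> 0" "\<exists>y\<in>V'. y \<noteq> 0"
      using assms(9,10) unfolding proj_def by auto
  qed fact+
  have "G_submodule G \<rho>L (generic_vectors m)"
    using G_submodule_generic_vectors[OF assms(3) _ assms(7) assms(12)] assms(2)
    unfolding irreducible_G_module_def by blast
  then have "generic_vectors m = {0} \<or> generic_vectors m = UNIV"
    using assms(2) unfolding irreducible_G_module_def by blast
  moreover obtain p where "meets_in_dim m (generic_dim V V' T U m) p"
    and p: "span_of_tuple m T (fst p) \<inter> U (proj_pt (snd p)) \<subseteq> generic_vectors m"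
    using generic_intersection_subset_generic_vectors[OF assms(15)] by blast
  then have "vec.dim (span_of_tuple m T (fst p) \<inter> U (proj_pt (snd p))) \<noteq> 0"
    using assms(16) by (simp add: meets_in_dim_def split_beta)
  then have "generic_vectors m \<noteq> {0}"
    using p by (auto simp: vec.dim_eq_0)
  ultimately have span: "generic_on (tuple_coords m) (tuples m)
      (\<lambda>x. (\<forall>i<m. x i \<noteq> 0) \<and> span_of_tuple m T x = UNIV)"
    by (intro generic_vectors_UNIV_imp_generic_span) blast
  then have "generically (power_space m V)
      (\<lambda>x. (\<forall>i<m. x i \<noteq> 0) \<and> span_of_tuple m T x = UNIV)"
    unfolding power_space_def generically_iff_generic_on .
  then show ?thesis
    using generic_dim_eq_if_generic_span[OF span] by blast
qed

end
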